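(* For every constant $\epsilon\in(0,1)$ there exist a constant $K=K(\epsilon)$ and a deterministic exponential-time mechanism (running in time $2^{\mathrm{poly}(n)}$) that, for every $n\ge 2$ and every ordinal matching problem instance with $n$ agents and $n$ items, outputs a matching $M$ of size $\lceil(1-\epsilon)n\rceil$ guaranteed to have distortion at most $O(\log^2 n)$: for every metric $d$ consistent with the instance, $\mathrm{cost}_d(M)\le K(\log n)^2\cdot\mathrm{cost}_d(M_{\mathrm{OPT}})$, where $M_{\mathrm{OPT}}$ is a minimum-cost perfect matching with respect to $d$.
   Context: Agents $A=\{a_1,\dots,a_n\}$ and items $B=\{b_1,\dots,b_n\}$. A metric is a function $d:(A\cup B)\times(A\cup B)\to\mathbb{R}_{\ge 0}$ with $d(x,x)=0$, $d(x,y)=d(y,x)$ and $d(x,y)\le d(x,z)+d(z,y)$ (distinct points are allowed to be at distance $0$). An ordinal matching problem instance consists of $n$ preference lists, one per agent; each list is a permutation of $B$. A metric $d$ is consistent with the instance if, for every agent $a_i$, whenever $b_j$ appears before $b_k$ in the list of $a_i$ we have $d(a_i,b_j)\le d(a_i,b_k)$. A (not necessarily perfect) matching $M$ is a set of agent-item pairs in which each agent and each item appears at most once; $\mathrm{cost}_d(M)=\sum_{(a,b)\in M}d(a,b)$. A perfect matching has $n$ pairs. A deterministic mechanism is a function mapping each instance (it sees only the preference lists, not $d$) to a matching.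
   Formalization: For irrational ε the exponential-time algorithm is also given the number ⌈(1-ε)n⌉ as input, since for a non-computable ε no algorithm can output matchings of that size; for rational ε it sees only the preference lists. *)

theory Defs
  imports Complex_Main "HOL-Computational_Algebra.Polynomial"
begin

section \<open>Ordinal matching instances\<close>

text \<open>Agents and items are numbered from 0 to n - 1. Metrics live on the disjoint union.\<close>

datatype point = Agent nat | Item nat

definition points :: "nat \<Rightarrow> point set" where
  "points n = Agent ` {..<n} \<union> Item ` {..<n}"

text \<open>Distinct points may have distance 0, so this is weaker than the library's metric spaces.\<close>

definition is_metric :: "nat \<Rightarrow> (point \<Rightarrow> point \<Rightarrow> real) \<Rightarrow> bool" where
  "is_metric n d \<longleftrightarrow>
     (\<forall>x\<in>points n. \<forall>y\<in>points n. 0 \<le> d x y) \<and>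
     (\<forall>x\<in>points n. d x x = 0) \<and>
     (\<forall>x\<in>points n. \<forall>y\<in>points n. d x y = d y x) \<and>
     (\<forall>x\<in>points n. \<forall>y\<in>points n. \<forall>z\<in>points n. d x y \<le> d x z + d z y)"

text \<open>The list \<open>P ! i\<close> ranks all items for agent \<open>i\<close>, best item first.\<close>

definition is_instance :: "nat \<Rightarrow> nat list list \<Rightarrow> bool" where
  "is_instance n P \<longleftrightarrow> length P = n \<and> (\<forall>i<n. distinct (P ! i) \<and> set (P ! i) = {..<n})"

definition consistent :: "nat list list \<Rightarrow> (point \<Rightarrow> point \<Rightarrow> real) \<Rightarrow> bool" where
  "consistent P d \<longleftrightarrow>
     (\<forall>i<length P. \<forall>k<length (P ! i). \<forall>j<k.
        d (Agent i) (Item (P ! i ! j)) \<le> d (Agent i) (Item (P ! i ! k)))"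

definition is_matching :: "nat \<Rightarrow> (nat \<times> nat) set \<Rightarrow> bool" where
  "is_matching n M \<longleftrightarrow> M \<subseteq> {..<n} \<times> {..<n} \<and> inj_on fst M \<and> inj_on snd M"

definition is_perfect_matching :: "nat \<Rightarrow> (nat \<times> nat) set \<Rightarrow> bool" where
  "is_perfect_matching n M \<longleftrightarrow> is_matching n M \<and> card M = n"

definition cost :: "(point \<Rightarrow> point \<Rightarrow> real) \<Rightarrow> (nat \<times> nat) set \<Rightarrow> real" where
  "cost d M = (\<Sum>(a, b)\<in>M. d (Agent a) (Item b))"

definition is_min_cost_perfect_matching ::
    "nat \<Rightarrow> (point \<Rightarrow> point \<Rightarrow> real) \<Rightarrow> (nat \<times> nat) set \<Rightarrow> bool" where
  "is_min_cost_perfect_matching n d M \<longleftrightarrow>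
     is_perfect_matching n M \<and> (\<forall>M'. is_perfect_matching n M' \<longrightarrow> cost d M \<le> cost d M')"

definition is_mechanism :: "(nat list list \<Rightarrow> (nat \<times> nat) set) \<Rightarrow> bool" where
  "is_mechanism f \<longleftrightarrow> (\<forall>n P. is_instance n P \<longrightarrow> is_matching n (f P))"

definition target_size :: "real \<Rightarrow> nat \<Rightarrow> nat" where
  "target_size \<epsilon> n = nat \<lceil>(1 - \<epsilon>) * real n\<rceil>"


section \<open>A model of computation with running times\<close>

text \<open>
  Running time is measured in first-order pure Lisp (cf. the language F in N. D. Jones,
  Computability and Complexity, with several arguments per function): data are binary trees
  over a single atom, and a program is a finite list of mutually recursive function bodies.
  Every evaluated expression node costs one step. With trees stored as shared heap cells, each
  step takes time polynomial in the number of steps so far on a Turing machine, and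
  conversely Turing machines are simulated with constant-factor overhead. On outputs of
  polynomial size, \<open>2^poly(n)\<close> time therefore means the same as for Turing machines.
\<close>

datatype data = Atom | Cell data data

fun car :: "data \<Rightarrow> data" where
  "car Atom = Atom"
| "car (Cell u v) = u"

fun cdr :: "data \<Rightarrow> data" where
  "cdr Atom = Atom"
| "cdr (Cell u v) = v"

text \<open>
  \<open>EVar i\<close> is the \<open>i\<close>-th argument of the current function, \<open>EIf\<close> treats \<open>Atom\<close>
  as false, and \<open>ECall g es\<close> calls (by value) the \<open>g\<close>-th function of the program.
\<close>

datatype expr =
    EVar nat
  | EAtom
  | ECons expr expr
  | ECar expr
  | ECdr expr
  | EIf expr expr expr
  | ECall nat "expr list"

text \<open>\<open>evaluates fs env e v t\<close>: with arguments \<open>env\<close>, expression \<open>e\<close> evaluates to \<open>v\<close> in \<open>t\<close> steps.\<close>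

inductive evaluates :: "expr list \<Rightarrow> data list \<Rightarrow> expr \<Rightarrow> data \<Rightarrow> nat \<Rightarrow> bool"
  and evaluates_list :: "expr list \<Rightarrow> data list \<Rightarrow> expr list \<Rightarrow> data list \<Rightarrow> nat \<Rightarrow> bool"
  for fs :: "expr list" where
  Var: "i < length env \<Longrightarrow> evaluates fs env (EVar i) (env ! i) 1"
| Atom: "evaluates fs env EAtom Atom 1"
| Cons: "evaluates fs env e1 v1 t1 \<Longrightarrow> evaluates fs env e2 v2 t2 \<Longrightarrow>
    evaluates fs env (ECons e1 e2) (Cell v1 v2) (t1 + t2 + 1)"
| Car: "evaluates fs env e v t \<Longrightarrow> evaluates fs env (ECar e) (car v) (t + 1)"
| Cdr: "evaluates fs env e v t \<Longrightarrow> evaluates fs env (ECdr e) (cdr v) (t + 1)"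
| IfT: "evaluates fs env e u t1 \<Longrightarrow> u \<noteq> Atom \<Longrightarrow> evaluates fs env e1 v t2 \<Longrightarrow>
    evaluates fs env (EIf e e1 e2) v (t1 + t2 + 1)"
| IfF: "evaluates fs env e Atom t1 \<Longrightarrow> evaluates fs env e2 v t2 \<Longrightarrow>
    evaluates fs env (EIf e e1 e2) v (t1 + t2 + 1)"
| Call: "evaluates_list fs env es vs t1 \<Longrightarrow> g < length fs \<Longrightarrow> evaluates fs vs (fs ! g) v t2 \<Longrightarrow>
    evaluates fs env (ECall g es) v (t1 + t2 + 1)"
| Nil: "evaluates_list fs env [] [] 0"
| More: "evaluates fs env e v t1 \<Longrightarrow> evaluates_list fs env es vs t2 \<Longrightarrow>
    evaluates_list fs env (e # es) (v # vs) (t1 + t2)"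

lemma evaluates_deterministic:
  "evaluates fs env e v t \<Longrightarrow> evaluates fs env e v' t' \<Longrightarrow> v = v' \<and> t = t'"
  "evaluates_list fs env es vs s \<Longrightarrow> evaluates_list fs env es vs' s' \<Longrightarrow> vs = vs' \<and> s = s'"
proof (induction arbitrary: v' t' and vs' s' rule: evaluates_evaluates_list.inducts)
  case (Var i env) then show ?case by (auto elim: evaluates.cases)
next
  case (Atom env) then show ?case by (auto elim: evaluates.cases)
next
  case (Cons env e1 v1 t1 e2 v2 t2)
  from Cons.prems show ?case by cases (use Cons.IH in blast)
next
  case (Car env e v t)
  from Car.prems show ?case by cases (use Car.IH in blast)
next
  case (Cdr env e v t)
  from Cdr.prems show ?case by cases (use Cdr.IH in blast)
next
  case (IfT env e u t1 e1 v t2 e2)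
  from IfT.prems show ?case by cases (use IfT.IH IfT.hyps in blast)+
next
  case (IfF env e t1 e2 v t2 e1)
  from IfF.prems show ?case by cases (use IfF.IH in blast)+
next
  case (Call env es vs t1 g v t2)
  from Call.prems show ?case by cases (use Call.IH in blast)
next
  case (Nil env) then show ?case by (auto elim: evaluates_list.cases)
next
  case (More env e v t1 es vs t2)
  from More.prems show ?case by cases (use More.IH in blast)
qed

text \<open>Function 0 is the entry point of a program.\<close>

definition runs_within :: "expr list \<Rightarrow> data list \<Rightarrow> data \<Rightarrow> nat \<Rightarrow> bool" where
  "runs_within fs args v b \<longleftrightarrow> fs \<noteq> [] \<and> (\<exists>t\<le>b. evaluates fs args (fs ! 0) v t)"

text \<open>
  Numbers are unary. An instance with n agents then has size polynomial in n, so the choice of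
  encoding does not affect \<open>2^poly(n)\<close> bounds.
\<close>

fun enc_nat :: "nat \<Rightarrow> data" where
  "enc_nat 0 = Atom"
| "enc_nat (Suc n) = Cell Atom (enc_nat n)"

fun enc_list :: "('a \<Rightarrow> data) \<Rightarrow> 'a list \<Rightarrow> data" where
  "enc_list enc [] = Atom"
| "enc_list enc (x # xs) = Cell (enc x) (enc_list enc xs)"

definition enc_pair :: "nat \<times> nat \<Rightarrow> data" where
  "enc_pair p = Cell (enc_nat (fst p)) (enc_nat (snd p))"

definition enc_instance :: "nat list list \<Rightarrow> data" where
  "enc_instance P = enc_list (enc_list enc_nat) P"

text \<open>
  A single program must handle all n. \<open>input P\<close> lists the arguments handed to it on
  instance \<open>P\<close>; the program outputs the matching as a list of pairs.
\<close>

definition exp_time_computable ::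
    "(nat list list \<Rightarrow> data list) \<Rightarrow> (nat list list \<Rightarrow> (nat \<times> nat) set) \<Rightarrow> bool" where
  "exp_time_computable input f \<longleftrightarrow>
     (\<exists>fs (p :: nat poly). \<forall>n P. is_instance n P \<longrightarrow>
        (\<exists>xs. distinct xs \<and> set xs = f P \<and>
              runs_within fs (input P) (enc_list enc_pair xs) (2 ^ poly p n)))"

text \<open>
  Any program producing a matching of size \<open>\<lceil>(1 - \<epsilon>) n\<rceil>\<close> also computes that number, which is
  impossible if \<open>\<epsilon>\<close> is a non-computable real. For arbitrary real \<open>\<epsilon>\<close> the
  program is therefore told the number of pairs to output; for rational \<open>\<epsilon>\<close> it gets the
  preference lists only.
\<close>

definition is_exp_time_mechanism ::
    "real \<Rightarrow> (nat list list \<Rightarrow> (nat \<times> nat) set) \<Rightarrow> bool" where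
  "is_exp_time_mechanism \<epsilon> f \<longleftrightarrow>
     is_mechanism f \<and>
     exp_time_computable (\<lambda>P. [enc_instance P, enc_nat (target_size \<epsilon> (length P))]) f \<and>
     (\<epsilon> \<in> \<rat> \<longrightarrow> exp_time_computable (\<lambda>P. [enc_instance P]) f)"

end

theory Submission
  imports Defs "HOL-Analysis.Lebesgue_Measure" "HOL-Analysis.Bochner_Integration"
begin

text \<open>
  Run serial dictatorship in all orders, stopping halfway between the target size and \<open>n\<close>. The
  average cost of these runs is a constant times the optimum, for every consistent metric, so
  their union \<open>X\<close> is a cheap fractional matching that depends on the preferences only. It is
  rounded to a matching \<open>M\<close> that is thin: no cut separates more than \<open>k\<close> times as many edges of
  \<open>M\<close> as of \<open>X\<close> (suitably normalized). An expander decomposition of \<open>X\<close> shows that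
  \<open>k = O(log n)\<close> is attainable with a loss of few edges, and Bourgain's embedding argument shows
  that thin matchings cost at most \<open>O(k log n)\<close> times as much as \<open>X\<close>. The mechanism searches for
  the thinnest matching by brute force.
\<close>

section \<open>Cuts and metrics\<close>

text \<open>The mechanism cannot see \<open>d\<close>, so its output needs a certificate that is
  valid for all consistent metrics at once. Cut counts are of this kind: they are computed from M
  and \<open>X\<close> alone, and a metric enters only in the analysis, when the cut inequalities
  are integrated over neighbourhoods of point sets. Comparing cuts also frees the pairs of M from
  being edges of \<open>X\<close>: inside an expanding part, any maximum matching between its agents
  and its items will do.

  Stopping halfway splits the slack \<open>\<epsilon> * n\<close> in two. One half of it stays
  unserved, which keeps \<open>k / (n - k + 1)\<close>, the guaranteed cost ratio after k dictator
  steps, below \<open>2 / \<epsilon>\<close>; run to the end, this guarantee would degrade to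
  \<open>n\<close>. The other half is surplus that the expander decomposition is allowed to destroy.
  The two logarithms have separate origins: one counts how often a vertex can lie on the smaller
  side of a sparse cut, the other is the number of sampling densities that are needed to match every
  ball size up to \<open>2 * n\<close>.\<close>

fun separates :: "point set \<Rightarrow> nat \<times> nat \<Rightarrow> bool" where
  "separates U (a, b) \<longleftrightarrow> (Agent a \<in> U) \<noteq> (Item b \<in> U)"

fun dist_of :: "(point \<Rightarrow> point \<Rightarrow> real) \<Rightarrow> nat \<times> nat \<Rightarrow> real" where
  "dist_of d (a, b) = d (Agent a) (Item b)"

definition crossing :: "point set \<Rightarrow> (nat \<times> nat) list \<Rightarrow> nat" where
  "crossing U L = length (filter (separates U) L)"

text \<open>Each length is the Lebesgue measure of an interval of radii, so the claim is the
  integral over \<open>r\<close> of the pointwise hypothesis. This turns cut inequalities at single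
  radii into an inequality between distances.\<close>

lemma sum_interval_lengths_mono:
  fixes \<alpha> h :: "'i \<Rightarrow> real" and \<beta> l u :: "'j \<Rightarrow> real"
  assumes fin: "finite I" "finite J"
    and h: "\<And>i. i \<in> I \<Longrightarrow> 0 \<le> h i" and lu: "\<And>j. j \<in> J \<Longrightarrow> l j \<le> u j"
    and le: "\<And>r. (\<Sum>i\<in>I. \<alpha> i * indicator {0..<h i} r) \<le> (\<Sum>j\<in>J. \<beta> j * indicator {l j..<u j} r)"
  shows "(\<Sum>i\<in>I. \<alpha> i * h i) \<le> (\<Sum>j\<in>J. \<beta> j * (u j - l j))"
proof -
  have int: "integrable lborel (indicat_real {x..<y})" if "x \<le> y" for x y :: real
    using that by (simp add: integrable_real_indicator)
  have len: "integral\<^sup>L lborel (indicat_real {x..<y}) = y - x" if "x \<le> y" for x y :: real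
    using that by simp
  have "(\<Sum>i\<in>I. \<alpha> i * h i) = (\<Sum>i\<in>I. integral\<^sup>L lborel (\<lambda>r. \<alpha> i * indicator {0..<h i} r))"
    by (rule sum.cong) (use h len in auto)
  also have "\<dots> = integral\<^sup>L lborel (\<lambda>r. \<Sum>i\<in>I. \<alpha> i * indicator {0..<h i} r)"
    by (rule Bochner_Integration.integral_sum[symmetric]) (use h int in auto)
  also have "\<dots> \<le> integral\<^sup>L lborel (\<lambda>r. \<Sum>j\<in>J. \<beta> j * indicator {l j..<u j} r)"
    by (rule integral_mono)
       (use h lu int le in \<open>auto intro!: Bochner_Integration.integrable_sum integrable_mult_right\<close>)
  also have "\<dots> = (\<Sum>j\<in>J. integral\<^sup>L lborel (\<lambda>r. \<beta> j * indicator {l j..<u j} r))"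
    by (rule Bochner_Integration.integral_sum) (use lu int in auto)
  also have "\<dots> = (\<Sum>j\<in>J. \<beta> j * (u j - l j))"
    by (rule sum.cong) (use lu len in auto)
  finally show ?thesis .
qed

section \<open>Random point samples of dyadic density\<close>

definition sample_weight :: "'a set \<Rightarrow> real \<Rightarrow> 'a set \<Rightarrow> real" where
  "sample_weight V p A = p ^ card A * (1 - p) ^ card (V - A)"

lemma sample_weight_nonneg: "0 \<le> p \<Longrightarrow> p \<le> 1 \<Longrightarrow> 0 \<le> sample_weight V p A"
  by (simp add: sample_weight_def)

text \<open>\<open>sample_weight\<close> is the probability that a random subset of
  \<open>V\<close>, containing each point independently with probability \<open>p\<close>, equals
  \<open>A\<close>. Finite weighted sums take the place of a probability space.\<close>

lemma sum_sample_weight_avoiding: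
  assumes "finite V" "S \<subseteq> V"
  shows "(\<Sum>A | A \<subseteq> V \<and> A \<inter> S = {}. sample_weight V p A) = (1 - p) ^ card S"
proof -
  \<comment> \<open>The value 0 on \<open>S\<close> wipes out every \<open>A\<close> that meets
    \<open>S\<close>, so the sum extends to all of \<open>Pow V\<close> and factorizes over the
    points by \<open>prod_add\<close>.\<close>
  define f where "f = (\<lambda>v. if v \<in> S then 0 else p)"
  have "(\<Sum>A | A \<subseteq> V \<and> A \<inter> S = {}. sample_weight V p A)
      = (\<Sum>A\<in>Pow V. prod f A * prod (\<lambda>_. 1 - p) (V - A))"
  proof (rule sum.mono_neutral_cong_left)
    show "\<forall>A\<in>Pow V - {A. A \<subseteq> V \<and> A \<inter> S = {}}. prod f A * prod (\<lambda>_. 1 - p) (V - A) = 0"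
    proof
      fix A assume "A \<in> Pow V - {A. A \<subseteq> V \<and> A \<inter> S = {}}"
      then obtain v where "v \<in> A" "v \<in> S" "A \<subseteq> V" by auto
      then have "prod f A = 0"
        using assms finite_subset by (intro prod_zero) (auto simp: f_def)
      then show "prod f A * prod (\<lambda>_. 1 - p) (V - A) = 0" by simp
    qed
    show "sample_weight V p A = prod f A * prod (\<lambda>_. 1 - p) (V - A)"
      if "A \<in> {A. A \<subseteq> V \<and> A \<inter> S = {}}" for A
    proof -
      have "prod f A = prod (\<lambda>_. p) A" using that by (intro prod.cong) (auto simp: f_def)
      then show ?thesis by (simp add: sample_weight_def)
    qed
  qed (use assms in auto)
  also have "\<dots> = (\<Prod>v\<in>V. f v + (1 - p))" by (simp add: prod_add assms)
  also have "\<dots> = (\<Prod>v\<in>V. if v \<in> S then 1 - p else 1)"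
    by (intro prod.cong) (auto simp: f_def)
  also have "\<dots> = (1 - p) ^ card S"
    using assms by (simp add: prod.If_cases Int_absorb1)
  finally show ?thesis .
qed

text \<open>At density \<open>1 / 2 ^ t\<close>, a set of \<open>2 ^ (t - 1)\<close> points has
  expected sample size one half. A set with fewer than twice that many points is therefore missed
  with probability at least \<open>1/4\<close>, a set at least that large is hit with probability at
  least \<open>1/3\<close>, and disjointness makes the two events independent.\<close>

lemma sample_hits_and_avoids:
  fixes s t :: nat
  assumes "finite V" "S \<subseteq> V" "T \<subseteq> V" "S \<inter> T = {}" "1 \<le> t" "card S < 2 ^ t" "2 ^ (t - 1) \<le> card T"
  shows "(\<Sum>A | A \<subseteq> V \<and> A \<inter> S = {} \<and> A \<inter> T \<noteq> {}. sample_weight V (1 / 2 ^ t) A) \<ge> 1 / 12"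
proof -
  define p :: real where "p = 1 / 2 ^ t"
  define h :: nat where "h = 2 ^ (t - 1)"
  have t2: "2 ^ t = 2 * h" using assms by (cases t) (auto simp: h_def)
  then have hp: "real h * p = 1 / 2"
    by (simp add: p_def) (metis of_nat_mult of_nat_numeral of_nat_power t2 h_def nonzero_mult_divide_mult_cancel_right2 of_nat_eq_0_iff power_not_zero zero_neq_numeral mult.commute)
  have p: "0 < p" "p \<le> 1 / 2" using assms
    by (auto simp: p_def field_simps) (metis One_nat_def one_le_numeral power_increasing power_one_right)
  define q where "q = (1 - p) ^ h"
  have q_ge: "1 / 2 \<le> q"
    using Bernoulli_inequality[of "-p" h] p hp by (simp add: q_def)
  \<comment> \<open>Multiplying \<open>q\<close> by \<open>(1 + p) ^ h\<close>, which is at least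
    \<open>3/2\<close> by Bernoulli, gives \<open>(1 - p * p) ^ h \<le> 1\<close>.\<close>
  have q_le: "q \<le> 2 / 3"
  proof -
    have "q * (1 + real h * p) \<le> q * (1 + p) ^ h"
      using Bernoulli_inequality[of p h] p q_ge by (intro mult_left_mono) auto
    also have "\<dots> = (1 - p * p) ^ h"
      by (simp add: q_def power_mult_distrib[symmetric] algebra_simps)
    also have "\<dots> \<le> 1" using p by (intro power_le_one) (auto simp: mult_le_one)
    finally show ?thesis using hp by simp
  qed
  have s: "1 / 4 \<le> (1 - p) ^ card S"
  proof -
    have "1 / 4 \<le> q * q" using mult_mono[OF q_ge q_ge] q_ge by simp
    also have "\<dots> = (1 - p) ^ (2 ^ t)" by (simp add: q_def t2 mult_2 power_add)
    also have "\<dots> \<le> (1 - p) ^ card S" using assms p by (intro power_decreasing) auto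
    finally show ?thesis .
  qed
  have "(1 - p) ^ card T \<le> q"
    unfolding q_def using assms p by (intro power_decreasing) (auto simp: h_def)
  then have T: "(1 - p) ^ card T \<le> 2 / 3" using q_le by simp
  let ?w = "sample_weight V p"
  have eq: "{A. A \<subseteq> V \<and> A \<inter> S = {} \<and> A \<inter> T \<noteq> {}} =
      {A. A \<subseteq> V \<and> A \<inter> S = {}} - {A. A \<subseteq> V \<and> A \<inter> (S \<union> T) = {}}" by auto
  have "(\<Sum>A | A \<subseteq> V \<and> A \<inter> S = {} \<and> A \<inter> T \<noteq> {}. ?w A) =
      (\<Sum>A | A \<subseteq> V \<and> A \<inter> S = {}. ?w A) - (\<Sum>A | A \<subseteq> V \<and> A \<inter> (S \<union> T) = {}. ?w A)"
    unfolding eq using assms by (intro sum_diff) auto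
  also have "\<dots> = (1 - p) ^ card S - (1 - p) ^ card (S \<union> T)"
    using assms by (simp add: sum_sample_weight_avoiding)
  also have "card (S \<union> T) = card S + card T"
    using assms by (meson card_Un_disjoint finite_subset)
  also have "(1 - p) ^ card S - (1 - p) ^ (card S + card T) = (1 - p) ^ card S * (1 - (1 - p) ^ card T)"
    by (simp add: power_add algebra_simps)
  also have "\<dots> \<ge> 1 / 4 * (1 / 3)"
    using s T by (intro mult_mono) auto
  finally show ?thesis by (simp add: p_def)
qed

section \<open>Neighbourhoods of samples as cuts\<close>

definition nbhd :: "nat \<Rightarrow> (point \<Rightarrow> point \<Rightarrow> real) \<Rightarrow> point set \<Rightarrow> real \<Rightarrow> point set" where
  "nbhd n d A r = {u \<in> points n. \<exists>v\<in>A. d u v \<le> r}"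

lemma finite_points [simp]: "finite (points n)"
  by (simp add: points_def)

lemma card_points: "card (points n) = 2 * n"
proof -
  have "card (points n) = card (Agent ` {..<n}) + card (Item ` {..<n})"
    unfolding points_def by (rule card_Un_disjoint) auto
  then show ?thesis by (simp add: card_image inj_on_def)
qed

text \<open>The balls of radius \<open>r\<close> around \<open>x\<close> and \<open>y\<close> are
  disjoint. A sample that misses the ball of \<open>x\<close> and hits the ball of \<open>y\<close>
  has \<open>y\<close> but not \<open>x\<close> in its neighbourhood. A ball has at most
  \<open>2 * n < 2 ^ T\<close> points, so \<open>T\<close> densities cover all ball sizes.\<close>

lemma random_nbhd_separates_ordered:
  assumes m: "is_metric n d" and T: "2 * n < 2 ^ T"
    and x: "x \<in> points n" and y: "y \<in> points n" and r: "0 \<le> r" "2 * r < d x y"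
    and le: "card {v \<in> points n. d x v \<le> r} \<le> card {v \<in> points n. d y v \<le> r}"
  shows "\<exists>t\<in>{1..T}. 1 / 12 \<le> (\<Sum>A | A \<subseteq> points n \<and> (x \<in> nbhd n d A r) \<noteq> (y \<in> nbhd n d A r).
           sample_weight (points n) (1 / 2 ^ t) A)"
proof -
  let ?B = "\<lambda>z. {v \<in> points n. d z v \<le> r}"
  have "x \<in> ?B x" using m x r by (auto simp: is_metric_def)
  then have s0: "0 < card (?B x)" by (auto simp: card_gt_0_iff)
  have sT: "card (?B x) < 2 ^ T"
    using card_mono[of "points n" "?B x"] T by (simp add: card_points)
  \<comment> \<open>The least such \<open>t\<close> places the size of the ball of \<open>x\<close>
    between \<open>2 ^ (t - 1)\<close> and \<open>2 ^ t\<close>; the ball of \<open>y\<close> is at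
    least as large and inherits the lower bound.\<close>
  define t where "t = (LEAST t. card (?B x) < 2 ^ t)"
  have t1: "card (?B x) < 2 ^ t" using sT unfolding t_def by (rule LeastI)
  have tT: "t \<le> T" using sT unfolding t_def by (rule Least_le)
  have t0: "1 \<le> t"
  proof (rule ccontr)
    assume "\<not> 1 \<le> t"
    then have "t = 0" by simp
    have "card (?B x) < 1" using t1 unfolding \<open>t = 0\<close> power_0 .
    then show False using s0 by linarith
  qed
  have t2: "2 ^ (t - 1) \<le> card (?B x)"
    using not_less_Least[of "t - 1" "\<lambda>t. card (?B x) < 2 ^ t"] t0 by (simp add: t_def[symmetric])
  have disj: "?B x \<inter> ?B y = {}"
  proof (rule ccontr)
    assume "?B x \<inter> ?B y \<noteq> {}"
    then obtain v where v: "v \<in> points n" "d x v \<le> r" "d y v \<le> r" by auto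
    have "d x y \<le> d x v + d v y" "d v y = d y v" using m x y v unfolding is_metric_def by blast+
    then show False using v r by simp
  qed
  have "1 / 12 \<le> (\<Sum>A | A \<subseteq> points n \<and> A \<inter> ?B x = {} \<and> A \<inter> ?B y \<noteq> {}.
      sample_weight (points n) (1 / 2 ^ t) A)"
    by (rule sample_hits_and_avoids) (use disj t0 t1 t2 le in auto)
  also have "\<dots> \<le> (\<Sum>A | A \<subseteq> points n \<and> (x \<in> nbhd n d A r) \<noteq> (y \<in> nbhd n d A r).
      sample_weight (points n) (1 / 2 ^ t) A)"
  proof (rule sum_mono2)
    show "0 \<le> sample_weight (points n) (1 / 2 ^ t) A" for A
      by (rule sample_weight_nonneg) auto
  qed (use x y in \<open>auto simp: nbhd_def\<close>)
  finally show ?thesis using t0 tT by auto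
qed

lemma random_nbhd_separates:
  assumes m: "is_metric n d" and T: "2 * n < 2 ^ T"
    and x: "x \<in> points n" and y: "y \<in> points n" and r: "0 \<le> r" "2 * r < d x y"
  shows "\<exists>t\<in>{1..T}. 1 / 12 \<le> (\<Sum>A | A \<subseteq> points n \<and> (x \<in> nbhd n d A r) \<noteq> (y \<in> nbhd n d A r).
           sample_weight (points n) (1 / 2 ^ t) A)"
proof (cases "card {v \<in> points n. d x v \<le> r} \<le> card {v \<in> points n. d y v \<le> r}")
  case True
  then show ?thesis by (rule random_nbhd_separates_ordered[OF assms])
next
  case False
  have "d y x = d x y" using m x y by (auto simp: is_metric_def)
  then have *: "2 * r < d y x" using r by simp
  have "(y \<in> N) \<noteq> (x \<in> N) \<longleftrightarrow> (x \<in> N) \<noteq> (y \<in> N)" for N by auto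
  with random_nbhd_separates_ordered[OF m T y x r(1) *] False show ?thesis by simp
qed

text \<open>A point lies in the neighbourhood exactly when its distance to \<open>A\<close> is at
  most \<open>r\<close>, so \<open>x\<close> and \<open>y\<close> are told apart for the radii
  between their distances to \<open>A\<close>. These differ by at most \<open>d x y\<close> because
  the distance to a set is 1-Lipschitz. For empty \<open>A\<close> all neighbourhoods are empty, and
  so is the interval.\<close>

lemma nbhd_separation_interval:
  assumes m: "is_metric n d" and A: "A \<subseteq> points n"
    and x: "x \<in> points n" and y: "y \<in> points n"
  shows "\<exists>l u. 0 \<le> l \<and> l \<le> u \<and> u - l \<le> d x y \<and>
    (\<forall>r. (x \<in> nbhd n d A r) \<noteq> (y \<in> nbhd n d A r) \<longleftrightarrow> l \<le> r \<and> r < u)"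
proof (cases "A = {}")
  case True
  then show ?thesis using m x y by (intro exI[of _ 0]) (auto simp: nbhd_def is_metric_def)
next
  case False
  have fin: "finite A" using A finite_points finite_subset by blast
  define f where "f z = Min (d z ` A)" for z
  have nb: "z \<in> nbhd n d A r \<longleftrightarrow> f z \<le> r" if "z \<in> points n" for z r
    using that fin False by (auto simp: nbhd_def f_def Min_le_iff)
  have f0: "0 \<le> f z" if "z \<in> points n" for z
    using that fin False A m by (auto simp: f_def is_metric_def subset_iff)
  have lip: "f z \<le> d z w + f w" if "z \<in> points n" "w \<in> points n" for z w
  proof -
    obtain v where v: "v \<in> A" "f w = d w v"
      using Min_in[of "d w ` A"] fin False unfolding f_def by (metis finite_imageI image_iff image_is_empty)
    have "f z \<le> d z v" using v fin by (auto simp: f_def)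
    also have "\<dots> \<le> d z w + d w v" using m that v A by (auto simp: is_metric_def subset_iff)
    finally show ?thesis using v by simp
  qed
  have "d y x = d x y" using m x y by (auto simp: is_metric_def)
  then show ?thesis using lip[OF x y] lip[OF y x] f0[OF x] f0[OF y]
    by (intro exI[of _ "min (f x) (f y)"] exI[of _ "max (f x) (f y)"])
       (auto simp: nb x y)
qed

lemma crossing_eq_sum: "real (crossing U L) = (\<Sum>i<length L. of_bool (separates U (L ! i)))"
proof -
  have "{..<length L} \<inter> {i. separates U (L ! i)} = {i. i < length L \<and> separates U (L ! i)}" by auto
  then show ?thesis by (simp add: crossing_def length_filter_conv_card sum_of_bool_eq)
qed

lemma separates_endpoints:
  "separates U e \<longleftrightarrow> (Agent (fst e) \<in> U) \<noteq> (Item (snd e) \<in> U)"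
  by (cases e) simp

lemma dist_of_endpoints: "dist_of d e = d (Agent (fst e)) (Item (snd e))"
  by (cases e) simp

text \<open>
  The argument of Bourgain's embedding theorem, carried out with cuts: for every radius below
  half its length, an edge is separated with constant probability by the neighbourhood of a
  random point set, for one of the \<open>T\<close> sampling densities.
\<close>

theorem cut_dominated_length:
  fixes \<alpha> \<kappa> :: real
  assumes m: "is_metric n d" and T: "2 * n < 2 ^ T"
    and M: "set M \<subseteq> {..<n} \<times> {..<n}" and X: "set X \<subseteq> {..<n} \<times> {..<n}"
    and \<alpha>: "0 \<le> \<alpha>" and \<kappa>: "0 \<le> \<kappa>"
    and dom: "\<And>U. \<alpha> * crossing U M \<le> \<kappa> * crossing U X"
  shows "\<alpha> * (\<Sum>e\<leftarrow>M. dist_of d e) \<le> 24 * T * \<kappa> * (\<Sum>e\<leftarrow>X. dist_of d e)"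
proof -
  let ?V = "points n"
  define w where "w t A = sample_weight ?V (1 / 2 ^ t) A" for t :: nat and A
  have w0: "0 \<le> w t A" for t A unfolding w_def by (rule sample_weight_nonneg) auto
  have w1: "(\<Sum>A\<in>Pow ?V. w t A) = 1" for t
    using sum_sample_weight_avoiding[of ?V "{}" "1 / 2 ^ t"] by (simp add: w_def Pow_def)
  have endp: "Agent (fst (L ! i)) \<in> ?V" "Item (snd (L ! i)) \<in> ?V"
    if "set L \<subseteq> {..<n} \<times> {..<n}" "i < length L" for L :: "(nat \<times> nat) list" and i
    using subsetD[OF that(1) nth_mem[OF that(2)]] by (auto simp: points_def)
  let ?P = "\<lambda>A j l u. 0 \<le> l \<and> l \<le> u \<and> u - l \<le> dist_of d (X ! j) \<and>
    (\<forall>r. separates (nbhd n d A r) (X ! j) \<longleftrightarrow> l \<le> r \<and> r < u)"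
  have "\<forall>A\<in>Pow ?V. \<forall>j<length X. \<exists>l u. ?P A j l u"
    using nbhd_separation_interval[OF m _ endp[OF X]]
    by (auto simp: separates_endpoints dist_of_endpoints)
  then obtain l u where lu: "\<And>A j. A \<subseteq> ?V \<Longrightarrow> j < length X \<Longrightarrow> ?P A j (l A j) (u A j)"
    unfolding Ball_def Pow_iff by metis
  define J where "J = {1..T} \<times> Pow ?V \<times> {..<length X}"
  have sum_J: "(\<Sum>k\<in>J. g k) = (\<Sum>t\<in>{1..T}. \<Sum>A\<in>Pow ?V. \<Sum>j<length X. g (t, A, j))"
    for g :: "nat \<times> point set \<times> nat \<Rightarrow> real"
    unfolding J_def by (simp add: sum.cartesian_product split_def)
  define \<beta> where "\<beta> = (\<lambda>(t, A, j :: nat). \<kappa> * w t A)"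
  \<comment> \<open>Separation is guaranteed only for \<open>2 * r < d x y\<close>, so half of each
    length is charged, with probability \<open>1/12\<close>. The two losses make up the factor
    24.\<close>
  have "(\<Sum>i<length M. (\<alpha> / 12) * (dist_of d (M ! i) / 2))
      \<le> (\<Sum>k\<in>J. \<beta> k * ((\<lambda>(t, A, j). u A j) k - (\<lambda>(t, A, j). l A j) k))"
  proof (rule sum_interval_lengths_mono)
    show "finite J" by (simp add: J_def)
    show "0 \<le> dist_of d (M ! i) / 2" if "i \<in> {..<length M}" for i
      using that endp[OF M] m by (auto simp: dist_of_endpoints is_metric_def)
    show "(\<lambda>(t, A, j). l A j) k \<le> (\<lambda>(t, A, j). u A j) k" if "k \<in> J" for k
      using that lu by (auto simp: J_def)
    fix r :: real
    show "(\<Sum>i<length M. \<alpha> / 12 * indicat_real {0..<dist_of d (M ! i) / 2} r)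
      \<le> (\<Sum>k\<in>J. \<beta> k * indicat_real {(\<lambda>(t, A, j). l A j) k..<(\<lambda>(t, A, j). u A j) k} r)"
    proof -
      have restrict: "(\<Sum>A | A \<subseteq> ?V \<and> Q A. g A) = (\<Sum>A\<in>Pow ?V. g A * of_bool (Q A))"
        for Q and g :: "point set \<Rightarrow> real"
        by (rule sum.mono_neutral_cong_left) auto
      have each: "1 / 12 * indicat_real {0..<dist_of d (M ! i) / 2} r
          \<le> (\<Sum>t\<in>{1..T}. \<Sum>A\<in>Pow ?V. w t A * of_bool (separates (nbhd n d A r) (M ! i)))"
        if i: "i < length M" for i
      proof (cases "0 \<le> r \<and> 2 * r < dist_of d (M ! i)")
        case True
        then obtain t where t: "t \<in> {1..T}" and le: "1 / 12 \<le> (\<Sum>A | A \<subseteq> ?V \<and>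
            separates (nbhd n d A r) (M ! i). w t A)"
          using random_nbhd_separates[OF m T endp[OF M i], of r]
          unfolding separates_endpoints dist_of_endpoints w_def by blast
        have "1 / 12 \<le> (\<Sum>A\<in>Pow ?V. w t A * of_bool (separates (nbhd n d A r) (M ! i)))"
          using le unfolding restrict .
        \<comment> \<open>The density that works depends on the edge and on the radius, so all of
          them are summed; this costs the factor \<open>T\<close>.\<close>
        also have "\<dots> \<le> (\<Sum>t\<in>{1..T}. \<Sum>A\<in>Pow ?V. w t A * of_bool (separates (nbhd n d A r) (M ! i)))"
          using t w0 by (intro member_le_sum) (auto intro!: sum_nonneg)
        finally show ?thesis using True by simp
      next
        case False
        then have "indicat_real {0..<dist_of d (M ! i) / 2} r = 0"
          by (auto simp: indicator_def)
        then show ?thesis using w0 by (auto intro!: sum_nonneg)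
      qed
      have "(\<Sum>i<length M. \<alpha> / 12 * indicat_real {0..<dist_of d (M ! i) / 2} r)
          = \<alpha> * (\<Sum>i<length M. 1 / 12 * indicat_real {0..<dist_of d (M ! i) / 2} r)"
        by (simp add: sum_distrib_left)
      also have "\<dots> \<le> \<alpha> * (\<Sum>i<length M. \<Sum>t\<in>{1..T}. \<Sum>A\<in>Pow ?V. w t A * of_bool (separates (nbhd n d A r) (M ! i)))"
        using each \<alpha> by (intro mult_left_mono sum_mono) auto
      also have "\<dots> = (\<Sum>t\<in>{1..T}. \<Sum>A\<in>Pow ?V. w t A * (\<alpha> * crossing (nbhd n d A r) M))"
        unfolding crossing_eq_sum sum_distrib_left
        by (subst sum.swap, rule sum.cong[OF refl], subst sum.swap) (simp add: mult_ac)
      \<comment> \<open>The cut hypothesis is applied to the neighbourhood of every possible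
        sample.\<close>
      also have "\<dots> \<le> (\<Sum>t\<in>{1..T}. \<Sum>A\<in>Pow ?V. w t A * (\<kappa> * crossing (nbhd n d A r) X))"
        using dom w0 by (intro sum_mono mult_left_mono) auto
      also have "\<dots> = (\<Sum>t\<in>{1..T}. \<Sum>A\<in>Pow ?V. \<Sum>j<length X.
          \<beta> (t, A, j) * indicat_real {l A j..<u A j} r)"
        unfolding crossing_eq_sum sum_distrib_left
        using lu by (intro sum.cong refl) (auto simp: \<beta>_def indicator_def)
      also have "\<dots> = (\<Sum>k\<in>J. \<beta> k * indicat_real {(\<lambda>(t, A, j). l A j) k..<(\<lambda>(t, A, j). u A j) k} r)"
        unfolding sum_J by simp
      finally show ?thesis .
    qed
  qed auto
  also have "\<dots> = (\<Sum>t\<in>{1..T}. \<Sum>A\<in>Pow ?V. \<Sum>j<length X. \<kappa> * w t A * (u A j - l A j))"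
    unfolding sum_J by (simp add: \<beta>_def)
  also have "\<dots> \<le> (\<Sum>t\<in>{1..T}. \<Sum>A\<in>Pow ?V. \<Sum>j<length X. \<kappa> * w t A * dist_of d (X ! j))"
    using lu w0 \<kappa> by (intro sum_mono mult_left_mono) auto
  also have "\<dots> = T * \<kappa> * (\<Sum>j<length X. dist_of d (X ! j))"
    by (simp add: sum_distrib_left[symmetric] sum_distrib_right[symmetric] w1)
  finally show ?thesis
    by (simp add: sum_list_sum_nth atLeast0LessThan sum_distrib_left[symmetric] sum_divide_distrib[symmetric])
qed

section \<open>Thin matchings\<close>

definition inside :: "point set \<Rightarrow> nat \<times> nat \<Rightarrow> bool" where
  "inside C e \<longleftrightarrow> Agent (fst e) \<in> C \<and> Item (snd e) \<in> C"

lemma length_filter_mem_le: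
  assumes "finite A" "\<And>a. length (filter (\<lambda>e. f e = a) L) \<le> N"
  shows "length (filter (\<lambda>e. f e \<in> A) L) \<le> N * card A"
  using assms(1)
proof (induction A rule: finite_induct)
  case (insert a A)
  have "length (filter (\<lambda>e. f e \<in> insert a A) L)
      \<le> length (filter (\<lambda>e. f e = a) L) + length (filter (\<lambda>e. f e \<in> A) L)"
    by (induction L) auto
  also have "\<dots> \<le> N + N * card A" using assms(2) insert.IH by (intro add_mono)
  finally show ?case using insert by simp
qed simp

lemma ex_maximal_matching:
  assumes "finite A" "finite B"
  shows "\<exists>M \<subseteq> A \<times> B. inj_on fst M \<and> inj_on snd M \<and> card M = min (card A) (card B)"
proof (cases "card A \<le> card B")
  case True
  then obtain f where f: "f ` A \<subseteq> B" "inj_on f A" using card_le_inj assms by blast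
  let ?M = "(\<lambda>a. (a, f a)) ` A"
  have "card ?M = card A" by (rule card_image) (auto simp: inj_on_def)
  then show ?thesis using f True by (intro exI[of _ ?M]) (auto simp: inj_on_def)
next
  case False
  then obtain f where f: "f ` B \<subseteq> A" "inj_on f B" using card_le_inj[of B A] assms by auto
  let ?M = "(\<lambda>b. (f b, b)) ` B"
  have "card ?M = card B" by (rule card_image) (auto simp: inj_on_def)
  then show ?thesis using f False by (intro exI[of _ ?M]) (auto simp: inj_on_def)
qed

text \<open>A separated edge has exactly one endpoint in \<open>U\<close>. Sending it there is
  injective, since distinct edges of a matching share no endpoint.\<close>

lemma card_separated_le:
  assumes "finite C" "M \<subseteq> {e. inside C e}" "inj_on fst M" "inj_on snd M"
  shows "card {e \<in> M. separates U e} \<le> card (U \<inter> C)"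
proof (rule card_inj_on_le)
  let ?f = "\<lambda>e. if Agent (fst e) \<in> U then Agent (fst e) else Item (snd e)"
  show "inj_on ?f {e \<in> M. separates U e}"
  proof (rule inj_onI)
    fix e e' assume *: "e \<in> {e \<in> M. separates U e}" "e' \<in> {e \<in> M. separates U e}" "?f e = ?f e'"
    then have "fst e = fst e' \<or> snd e = snd e'" by (auto split: if_splits)
    then show "e = e'" using * inj_onD[OF assms(3)] inj_onD[OF assms(4)] by blast
  qed
  show "?f ` {e \<in> M. separates U e} \<subseteq> U \<inter> C"
    using assms(2) by (auto simp: separates_endpoints inside_def)
qed (use assms in auto)

lemma separates_Compl: "separates (- U) e \<longleftrightarrow> separates U e"
  by (auto simp: separates_endpoints)

text \<open>This pays for one level of the decomposition: every element of the smaller part is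
  charged 1, and its logarithm grows by at least 1 because \<open>2 * s \<le> s + t\<close>.\<close>

lemma mult_log_superadditive:
  fixes s t :: nat
  assumes "1 \<le> s" "s \<le> t"
  shows "s * log 2 s + t * log 2 t + s \<le> (s + t) * log 2 (s + t)"
proof -
  have "log 2 s + 1 = log 2 (2 * s)" using assms by (simp add: log_mult)
  also have "\<dots> \<le> log 2 (s + t)" using assms by simp
  finally have "s * (log 2 s + 1) \<le> s * log 2 (s + t)" by (intro mult_left_mono) auto
  moreover have "t * log 2 t \<le> t * log 2 (s + t)" using assms by (intro mult_left_mono) auto
  ultimately show ?thesis by (simp add: algebra_simps)
qed

text \<open>The pairs of \<open>M\<close> need not occur in \<open>X\<close>. A maximum matching
  between all agents and all items of an expanding set is already thin, since a cut separates at
  most as many of its edges as the smaller side has vertices. By the degree bound, the edges of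
  \<open>X\<close> inside \<open>C\<close> number at most \<open>N\<close> times the smaller of the
  two vertex classes, which is the size of \<open>M\<close>.\<close>

lemma thin_matching_in_expander:
  fixes \<phi> :: real
  assumes C: "finite C" and \<phi>: "0 \<le> \<phi>"
    and deg: "\<And>a. length (filter (\<lambda>e. fst e = a) X) \<le> N" "\<And>b. length (filter (\<lambda>e. snd e = b) X) \<le> N"
    and exp: "\<And>U. U \<subseteq> C \<Longrightarrow> \<phi> * N * min (card U) (card (C - U)) \<le> crossing U (filter (inside C) X)"
  shows "\<exists>M \<subseteq> {e. inside C e}. inj_on fst M \<and> inj_on snd M \<and>
    (\<forall>U. \<phi> * N * card {e \<in> M. separates U e} \<le> crossing U (filter (inside C) X)) \<and>
    length (filter (inside C) X) \<le> N * card M"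
proof -
  define A where "A = {a. Agent a \<in> C}"
  define B where "B = {b. Item b \<in> C}"
  have fin: "finite A" "finite B"
    using finite_vimageI[OF C, of Agent] finite_vimageI[OF C, of Item]
    by (auto simp: A_def B_def inj_on_def vimage_def)
  obtain M where M: "M \<subseteq> A \<times> B" "inj_on fst M" "inj_on snd M" "card M = min (card A) (card B)"
    using ex_maximal_matching[OF fin] by blast
  have MC: "M \<subseteq> {e. inside C e}" using M(1) by (auto simp: inside_def A_def B_def)
  have thin: "\<phi> * N * card {e \<in> M. separates U e} \<le> crossing U (filter (inside C) X)" for U
  proof -
    have "card {e \<in> M. separates U e} \<le> card (- U \<inter> C)"
      using card_separated_le[OF C MC M(2,3), of "- U"] by (simp add: separates_Compl)
    also have "- U \<inter> C = C - U \<inter> C" by auto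
    finally have "card {e \<in> M. separates U e} \<le> min (card (U \<inter> C)) (card (C - U \<inter> C))"
      using card_separated_le[OF C MC M(2,3), of U] by simp
    then have "\<phi> * N * card {e \<in> M. separates U e} \<le> \<phi> * N * min (card (U \<inter> C)) (card (C - U \<inter> C))"
      using \<phi> by (intro mult_left_mono) auto
    also have "\<dots> \<le> crossing (U \<inter> C) (filter (inside C) X)"
      using exp[of "U \<inter> C"] by simp
    \<comment> \<open>Expansion is assumed for subsets of \<open>C\<close> only; edges inside
      \<open>C\<close> do not distinguish \<open>U\<close> from \<open>U \<inter> C\<close>.\<close>
    also have "crossing (U \<inter> C) (filter (inside C) X) = crossing U (filter (inside C) X)"
      unfolding crossing_def filter_filter
      by (intro arg_cong[of _ _ length] filter_cong) (auto simp: separates_endpoints inside_def)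
    finally show ?thesis .
  qed
  have "length (filter (inside C) X) \<le> length (filter (\<lambda>e. fst e \<in> A) X)"
    unfolding inside_def A_def by (induction X) auto
  moreover have "length (filter (inside C) X) \<le> length (filter (\<lambda>e. snd e \<in> B) X)"
    unfolding inside_def B_def by (induction X) auto
  ultimately have "length (filter (inside C) X) \<le> N * card M"
    using length_filter_mem_le[of A fst X N] length_filter_mem_le[of B snd X N] fin deg M(4)
    by (auto simp: min_def split: if_splits)
  then show ?thesis using M MC thin by blast
qed

text \<open>
  Recursive expander decomposition. Cutting \<open>C\<close> along a sparse cut loses at most \<open>\<phi> * N\<close>
  per vertex of the smaller side, and a vertex is on the smaller side at most \<open>log 2 (card C)\<close>
  times.
\<close>

theorem ex_thin_matching:
  fixes \<phi> :: real
  assumes "finite C" and \<phi>: "0 \<le> \<phi>"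
    and deg: "\<And>a. length (filter (\<lambda>e. fst e = a) X) \<le> N" "\<And>b. length (filter (\<lambda>e. snd e = b) X) \<le> N"
  shows "\<exists>M \<subseteq> {e. inside C e}. inj_on fst M \<and> inj_on snd M \<and>
    (\<forall>U. \<phi> * N * card {e \<in> M. separates U e} \<le> crossing U (filter (inside C) X)) \<and>
    length (filter (inside C) X) - \<phi> * N * (card C * log 2 (card C)) \<le> N * card M"
  using assms(1)
proof (induction "card C" arbitrary: C rule: less_induct)
  case less
  have fin: "finite C" by fact
  have logC: "0 \<le> real (card C) * log 2 (card C)"
    by (cases "card C = 0") auto
  show ?case
  proof (cases "\<forall>U\<subseteq>C. \<phi> * N * min (card U) (card (C - U)) \<le> crossing U (filter (inside C) X)")
    case True
    obtain M where M: "M \<subseteq> {e. inside C e}" "inj_on fst M" "inj_on snd M"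
      "\<forall>U. \<phi> * N * card {e \<in> M. separates U e} \<le> crossing U (filter (inside C) X)"
      "length (filter (inside C) X) \<le> N * card M"
      using thin_matching_in_expander[OF fin \<phi> deg] True by blast
    have "real (length (filter (inside C) X)) \<le> N * card M"
      using M(5) by (metis of_nat_le_iff of_nat_mult)
    moreover have "0 \<le> \<phi> * N * (card C * log 2 (card C))" using \<phi> logC by simp
    ultimately have "length (filter (inside C) X) - \<phi> * N * (card C * log 2 (card C)) \<le> N * card M"
      by simp
    then show ?thesis using M(1-4) by blast
  next
    case False
    then obtain U where U: "U \<subseteq> C" "crossing U (filter (inside C) X) < \<phi> * N * min (card U) (card (C - U))"
      by (auto simp: not_le)
    \<comment> \<open>The crossing number is symmetric under complement in \<open>C\<close>, so the
      smaller side may be called \<open>S\<close>.\<close>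
    have "crossing (C - U) (filter (inside C) X) = crossing U (filter (inside C) X)"
      unfolding crossing_def filter_filter
      by (intro arg_cong[of _ _ length] filter_cong) (auto simp: separates_endpoints inside_def)
    then obtain S T where ST: "S \<union> T = C" "S \<inter> T = {}" "card S \<le> card T"
      and cut: "crossing S (filter (inside C) X) < \<phi> * N * card S"
      using that[of U "C - U"] that[of "C - U" U] U
      by (cases "card U \<le> card (C - U)") auto
    have finST: "finite S" "finite T" using fin ST by auto
    \<comment> \<open>The strict inequality excludes an empty \<open>S\<close>; both sides are then
      nonempty, and the induction hypothesis applies to each.\<close>
    have S1: "1 \<le> card S" using cut by (cases "card S") auto
    have cC: "card C = card S + card T" using ST finST card_Un_disjoint by metis
    obtain M1 where M1: "M1 \<subseteq> {e. inside S e}" "inj_on fst M1" "inj_on snd M1"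
      "\<And>U. \<phi> * N * card {e \<in> M1. separates U e} \<le> crossing U (filter (inside S) X)"
      "length (filter (inside S) X) - \<phi> * N * (card S * log 2 (card S)) \<le> N * card M1"
      using less(1)[of S] cC S1 ST(3) finST by auto
    obtain M2 where M2: "M2 \<subseteq> {e. inside T e}" "inj_on fst M2" "inj_on snd M2"
      "\<And>U. \<phi> * N * card {e \<in> M2. separates U e} \<le> crossing U (filter (inside T) X)"
      "length (filter (inside T) X) - \<phi> * N * (card T * log 2 (card T)) \<le> N * card M2"
      using less(1)[of T] cC S1 ST(3) finST by auto
    have sub: "M1 \<union> M2 \<subseteq> {e. inside C e}" using M1(1) M2(1) ST(1) by (auto simp: inside_def)
    have "fst e1 \<noteq> fst e2 \<and> snd e1 \<noteq> snd e2" if "e1 \<in> M1" "e2 \<in> M2" for e1 e2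
    proof -
      have "inside S e1" "inside T e2" using that M1(1) M2(1) by auto
      then show ?thesis using ST(2) by (auto simp: inside_def)
    qed
    then have disj: "M1 \<inter> M2 = {}" "fst ` M1 \<inter> fst ` M2 = {}" "snd ` M1 \<inter> snd ` M2 = {}"
      by auto
    have finM: "finite M1" "finite M2"
    proof -
      have "finite {e. inside D e}" if "finite D" for D
      proof (rule finite_subset)
        show "{e. inside D e} \<subseteq> (Agent -` D) \<times> (Item -` D)" by (auto simp: inside_def)
        show "finite ((Agent -` D) \<times> (Item -` D))"
          using that by (intro finite_cartesian_product finite_vimageI) (auto simp: inj_on_def)
      qed
      then show "finite M1" "finite M2" using M1(1) M2(1) finST finite_subset by metis+
    qed
    have inj: "inj_on fst (M1 \<union> M2)" "inj_on snd (M1 \<union> M2)"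
      using M1(2,3) M2(2,3) disj(2,3) by (auto simp: inj_on_def)
    have thin: "\<phi> * N * card {e \<in> M1 \<union> M2. separates U e} \<le> crossing U (filter (inside C) X)" for U
    proof -
      have "card {e \<in> M1 \<union> M2. separates U e} = card {e \<in> M1. separates U e} + card {e \<in> M2. separates U e}"
        using disj(1) finM by (subst card_Un_disjoint[symmetric]) (auto intro: arg_cong[of _ _ card])
      then have "\<phi> * N * card {e \<in> M1 \<union> M2. separates U e}
          \<le> crossing U (filter (inside S) X) + crossing U (filter (inside T) X)"
        using M1(4)[of U] M2(4)[of U] by (simp add: algebra_simps)
      \<comment> \<open>No edge lies inside both parts, so the two counts are disjoint shares of the
        count for \<open>C\<close>.\<close>
      also have "crossing U (filter (inside S) X) + crossing U (filter (inside T) X)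
          \<le> crossing U (filter (inside C) X)"
        unfolding crossing_def ST(1)[symmetric] using ST(2) by (induction X) (auto simp: inside_def)
      finally show ?thesis by simp
    qed
    \<comment> \<open>An edge inside \<open>C\<close> lies inside \<open>S\<close>, inside
      \<open>T\<close>, or is cut by \<open>S\<close>; only the last kind is lost.\<close>
    have "length (filter (inside C) X)
        \<le> length (filter (inside S) X) + length (filter (inside T) X) + crossing S (filter (inside C) X)"
      unfolding crossing_def ST(1)[symmetric] using ST(2)
      by (induction X) (auto simp: inside_def separates_endpoints)
    then have "real (length (filter (inside C) X))
        \<le> length (filter (inside S) X) + length (filter (inside T) X) + crossing S (filter (inside C) X)"
      by (metis of_nat_add of_nat_mono)
    also have "\<dots> \<le> N * card M1 + N * card M2 + \<phi> * N * (card S * log 2 (card S))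
        + \<phi> * N * (card T * log 2 (card T)) + \<phi> * N * card S"
      using M1(5) M2(5) cut by simp
    also have "\<dots> = N * card (M1 \<union> M2)
        + \<phi> * N * (card S * log 2 (card S) + card T * log 2 (card T) + card S)"
      using disj(1) finM by (simp add: card_Un_disjoint algebra_simps)
    also have "\<dots> \<le> N * card (M1 \<union> M2) + \<phi> * N * (card C * log 2 (card C))"
      using mult_log_superadditive[OF S1 ST(3)] \<phi> unfolding cC
      by (intro add_left_mono mult_left_mono) auto
    finally have "length (filter (inside C) X) - \<phi> * N * (card C * log 2 (card C)) \<le> N * card (M1 \<union> M2)"
      by simp
    then show ?thesis using sub inj thin by (intro exI[of _ "M1 \<union> M2"]) auto
  qed
qed

section \<open>Serial dictatorship\<close>

definition choices :: "bool \<Rightarrow> 'a list \<Rightarrow> 'a list" where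
  "choices fl ps = (if fl then ps else take 1 ps)"

definition remove_pair :: "nat \<Rightarrow> nat \<Rightarrow> (nat \<times> nat list) list \<Rightarrow> (nat \<times> nat list) list" where
  "remove_pair i b R = map (\<lambda>(j, qs). (j, filter (\<lambda>c. c \<noteq> b) qs)) (filter (\<lambda>(j, qs). j \<noteq> i) R)"

text \<open>
  The state \<open>R\<close> lists the remaining agents with their preferences among the remaining items.
  Without the flag, \<open>runs\<close> lists the outcomes of \<open>k\<close> steps of serial dictatorship over all
  orders of the agents; with the flag, agents take arbitrary items and all matchings of size
  \<open>k\<close> appear.
\<close>

primrec runs :: "bool \<Rightarrow> nat \<Rightarrow> (nat \<times> nat list) list \<Rightarrow> (nat \<times> nat) list \<Rightarrow> (nat \<times> nat) list list" where
  "runs fl 0 R acc = [acc]"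
| "runs fl (Suc k) R acc = concat (map (\<lambda>(i, ps).
     concat (map (\<lambda>b. runs fl k (remove_pair i b R) ((i, b) # acc)) (choices fl ps))) R)"

definition is_state :: "(nat \<times> nat list) list \<Rightarrow> nat set \<Rightarrow> bool" where
  "is_state R I \<longleftrightarrow> distinct (map fst R) \<and> (\<forall>(i, ps)\<in>set R. distinct ps \<and> set ps = I)"

lemma set_remove_pair:
  "set (remove_pair i b R) = {(j, filter (\<lambda>c. c \<noteq> b) qs) | j qs. (j, qs) \<in> set R \<and> j \<noteq> i}"
  by (auto simp: remove_pair_def image_iff)

lemma fst_remove_pair: "map fst (remove_pair i b R) = filter (\<lambda>j. j \<noteq> i) (map fst R)"
  by (induction R) (auto simp: remove_pair_def)

lemma is_state_remove_pair: "is_state R I \<Longrightarrow> is_state (remove_pair i b R) (I - {b})"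
  by (auto simp: is_state_def fst_remove_pair set_remove_pair simp del: distinct_map)

lemma agents_remove_pair: "fst ` set (remove_pair i b R) = fst ` set R - {i}"
  using arg_cong[OF fst_remove_pair[of i b R], of set] by auto

lemma length_state: "is_state R I \<Longrightarrow> length R = card (fst ` set R)"
  by (metis is_state_def distinct_card length_map list.set_map)

lemma length_remove_pair:
  assumes "is_state R I" "i \<in> fst ` set R"
  shows "length (remove_pair i b R) = length R - 1"
  using assms length_state[OF assms(1)] length_state[OF is_state_remove_pair[OF assms(1)], of i b]
  by (simp add: agents_remove_pair)

lemma runs_sound:
  assumes "is_state R I" "xs \<in> set (runs fl k R acc)"
  shows "\<exists>ys. xs = ys @ acc \<and> length ys = k \<and> distinct (map fst ys) \<and> distinct (map snd ys)
    \<and> set ys \<subseteq> fst ` set R \<times> I"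
  using assms
proof (induction k arbitrary: R I acc)
  case (Suc k)
  then obtain i ps b where ips: "(i, ps) \<in> set R" and b: "b \<in> set (choices fl ps)"
    and xs: "xs \<in> set (runs fl k (remove_pair i b R) ((i, b) # acc))" by auto
  have bI: "b \<in> I"
    using b ips Suc.prems(1) by (auto simp: is_state_def choices_def dest: in_set_takeD split: if_splits)
  obtain ys where "xs = ys @ (i, b) # acc" "length ys = k" "distinct (map fst ys)" "distinct (map snd ys)"
      "set ys \<subseteq> fst ` set (remove_pair i b R) \<times> (I - {b})"
    using Suc.IH[OF is_state_remove_pair[OF Suc.prems(1)] xs] by blast
  moreover have "i \<in> fst ` set R" using ips by force
  ultimately show ?case using bI unfolding agents_remove_pair
    by (intro exI[of _ "ys @ [(i, b)]"]) auto
qed simp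

text \<open>Any pair of \<open>M\<close> may be chosen first: the other pairs avoid its agent and
  its item and are found in the reduced state.\<close>

lemma runs_complete:
  assumes "is_state R I" "finite M" "inj_on fst M" "inj_on snd M" "M \<subseteq> fst ` set R \<times> I" "card M = k"
  shows "\<exists>xs\<in>set (runs True k R acc). set xs = M \<union> set acc"
  using assms
proof (induction k arbitrary: R I M acc)
  case (Suc k)
  then obtain i b M' where M: "M = insert (i, b) M'" "(i, b) \<notin> M'" "card M' = k"
    by (metis card_Suc_eq surj_pair)
  obtain ps where ips: "(i, ps) \<in> set R" using Suc.prems M by auto
  have b: "b \<in> set ps" using ips Suc.prems M by (auto simp: is_state_def)
  have "M' \<subseteq> (fst ` set R - {i}) \<times> (I - {b})"
  proof
    fix e assume e: "e \<in> M'"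
    then have "e \<noteq> (i, b)" "e \<in> M" "(i, b) \<in> M" using M by auto
    then have "fst e \<noteq> i" "snd e \<noteq> b"
      using inj_onD[OF Suc.prems(3), of e "(i, b)"] inj_onD[OF Suc.prems(4), of e "(i, b)"] by auto
    then show "e \<in> (fst ` set R - {i}) \<times> (I - {b})"
      using \<open>e \<in> M\<close> Suc.prems(5) by (cases e) auto
  qed
  then obtain xs where xs: "xs \<in> set (runs True k (remove_pair i b R) ((i, b) # acc))"
      "set xs = M' \<union> set ((i, b) # acc)"
    using Suc.IH[OF is_state_remove_pair[OF Suc.prems(1)], of M' i b "(i, b) # acc"]
      Suc.prems M by (auto simp: agents_remove_pair inj_on_insert)
  then have "xs \<in> set (runs True (Suc k) R acc)" using ips b by (force simp: choices_def)
  then show ?case using xs M by (intro bexI[of _ xs]) auto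
qed simp

text \<open>The falling factorial: the number of ordered selections of \<open>k\<close> dictators
  among \<open>r\<close> agents.\<close>

primrec num_orders :: "nat \<Rightarrow> nat \<Rightarrow> nat" where
  "num_orders r 0 = 1"
| "num_orders r (Suc k) = r * num_orders (r - 1) k"

lemma num_orders_pos: "k \<le> r \<Longrightarrow> 0 < num_orders r k"
  by (induction k arbitrary: r) auto

lemma runs_dictator_Suc:
  assumes "is_state R I" "I \<noteq> {}"
  shows "runs False (Suc k) R acc =
    concat (map (\<lambda>(i, ps). runs False k (remove_pair i (hd ps) R) ((i, hd ps) # acc)) R)"
proof -
  have "choices False ps = [hd ps]" if "(i, ps) \<in> set R" for i ps
    using assms that by (cases ps) (auto simp: is_state_def choices_def)
  then show ?thesis by (auto intro!: arg_cong[of _ _ concat])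
qed

text \<open>A step removes one agent and one item, so their numbers stay equal and no preference
  list runs empty while agents remain.\<close>

lemma length_runs_dictator:
  assumes "is_state R I" "card I = length R" "k \<le> length R"
  shows "length (runs False k R acc) = num_orders (length R) k"
  using assms
proof (induction k arbitrary: R I acc)
  case (Suc k)
  then have "0 < card I" by linarith
  then have I: "I \<noteq> {}" "finite I" by (auto simp: card_gt_0_iff)
  have "length (runs False k (remove_pair i (hd ps) R) ((i, hd ps) # acc)) = num_orders (length R - 1) k"
    if "(i, ps) \<in> set R" for i ps
  proof -
    have "hd ps \<in> I" using that I Suc.prems(1) by (cases ps) (auto simp: is_state_def)
    moreover have "length (remove_pair i (hd ps) R) = length R - 1"
      using length_remove_pair[OF Suc.prems(1)] that by force
    ultimately show ?thesis
      using Suc.IH[OF is_state_remove_pair[OF Suc.prems(1)], of "hd ps" i] Suc.prems I by simp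
  qed
  then have "length (runs False (Suc k) R acc) = (\<Sum>x\<leftarrow>R. num_orders (length R - 1) k)"
    unfolding runs_dictator_Suc[OF Suc.prems(1) I(1)] length_concat map_map
    by (intro arg_cong[of _ _ sum_list] map_cong) auto
  then show ?case by (simp add: sum_list_triv)
qed simp

text \<open>If \<open>i\<close> takes \<open>b\<close>, the agent displaced from \<open>b\<close> is
  sent to the item that \<open>i\<close> gave up. The detour over \<open>b\<close> and
  \<open>i\<close> uses two edges that \<open>\<mu>\<close> has already paid for, so only
  \<open>d (Agent i) (Item b)\<close> is new.\<close>

lemma reroute_assignment:
  assumes m: "is_metric n d" and A: "A \<subseteq> {..<n}" and I: "I \<subseteq> {..<n}"
    and \<mu>: "bij_betw \<mu> A I" and i: "i \<in> A" and b: "b \<in> I"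
  shows "\<exists>\<mu>'. bij_betw \<mu>' (A - {i}) (I - {b}) \<and>
    (\<Sum>a\<in>A - {i}. d (Agent a) (Item (\<mu>' a))) \<le> (\<Sum>a\<in>A. d (Agent a) (Item (\<mu> a))) + d (Agent i) (Item b)"
proof -
  let ?d = "\<lambda>a c. d (Agent a) (Item c)"
  have fin: "finite A" using A finite_subset by blast
  have pt: "Agent a \<in> points n" if "a \<in> A" for a using that A by (auto simp: points_def)
  have qt: "Item c \<in> points n" if "c \<in> I" for c using that I by (auto simp: points_def)
  have \<mu>I: "\<mu> a \<in> I" if "a \<in> A" for a using that \<mu> by (auto simp: bij_betw_def)
  have inj: "\<mu> x = \<mu> y \<Longrightarrow> x = y" if "x \<in> A" "y \<in> A" for x y
    using that \<mu> by (auto simp: bij_betw_def inj_on_def)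
  have nonneg: "0 \<le> ?d a c" if "a \<in> A" "c \<in> I" for a c
    using m pt qt that by (auto simp: is_metric_def)
  obtain a' where a': "a' \<in> A" "\<mu> a' = b" using \<mu> b by (auto simp: bij_betw_def)
  show ?thesis
  proof (cases "a' = i")
    case True
    have "bij_betw \<mu> (A - {i}) (I - {b})"
      using \<mu> a' True i by (intro bij_betw_DiffI) (auto simp: bij_betw_def)
    moreover have "(\<Sum>a\<in>A - {i}. ?d a (\<mu> a)) \<le> (\<Sum>a\<in>A. ?d a (\<mu> a))"
      using fin nonneg \<mu>I by (intro sum_mono2) auto
    ultimately show ?thesis using nonneg[OF i b] by (intro exI[of _ \<mu>]) auto
  next
    case False
    let ?\<mu>' = "\<mu>(a' := \<mu> i)"
    have "bij_betw ?\<mu>' (A - {i}) (I - {b})"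
    proof (rule bij_betw_imageI)
      show "inj_on ?\<mu>' (A - {i})" using inj i a' by (auto simp: inj_on_def)
      show "?\<mu>' ` (A - {i}) = I - {b}"
      proof (intro equalityI subsetI)
        fix c assume "c \<in> ?\<mu>' ` (A - {i})"
        then obtain a where a: "a \<in> A" "a \<noteq> i" "c = ?\<mu>' a" by blast
        then show "c \<in> I - {b}"
          using inj[OF a(1) a'(1)] inj[OF i a'(1)] a' \<mu>I i False by (auto split: if_splits)
      next
        fix c assume c: "c \<in> I - {b}"
        then obtain a where a: "a \<in> A" "\<mu> a = c" using \<mu> by (auto simp: bij_betw_def)
        show "c \<in> ?\<mu>' ` (A - {i})"
        proof (cases "a = i")
          case True
          then have "c = ?\<mu>' a'" "a' \<in> A - {i}" using a a' False by auto
          then show ?thesis by (rule image_eqI)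
        next
          case neq: False
          then have "c = ?\<mu>' a" "a \<in> A - {i}" using a a' c by auto
          then show ?thesis by (rule image_eqI)
        qed
      qed
    qed
    moreover have "(\<Sum>a\<in>A - {i}. ?d a (?\<mu>' a)) \<le> (\<Sum>a\<in>A. ?d a (\<mu> a)) + ?d i b"
    proof -
      have t1: "?d a' (\<mu> i) \<le> ?d a' b + d (Item b) (Item (\<mu> i))"
        and t2: "d (Item b) (Item (\<mu> i)) \<le> d (Item b) (Agent i) + ?d i (\<mu> i)"
        and t3: "d (Item b) (Agent i) = ?d i b"
        using m pt[OF a'(1)] pt[OF i] qt[OF b] qt[OF \<mu>I[OF i]] unfolding is_metric_def by blast+
      have "(\<Sum>a\<in>A - {i}. ?d a (?\<mu>' a)) = ?d a' (\<mu> i) + (\<Sum>a\<in>A - {i} - {a'}. ?d a (?\<mu>' a))"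
        using fin a' False by (subst sum.remove[of _ a']) auto
      also have "(\<Sum>a\<in>A - {i} - {a'}. ?d a (?\<mu>' a)) = (\<Sum>a\<in>A - {i} - {a'}. ?d a (\<mu> a))"
        by (intro sum.cong) auto
      also have "?d a' (\<mu> i) + \<dots> \<le> (?d a' b + ?d i b + ?d i (\<mu> i)) + (\<Sum>a\<in>A - {i} - {a'}. ?d a (\<mu> a))"
        using t1 t2 t3 by simp
      also have "\<dots> = (\<Sum>a\<in>A. ?d a (\<mu> a)) + ?d i b"
        using fin a' False i sum.remove[of A i "\<lambda>a. ?d a (\<mu> a)"] sum.remove[of "A - {i}" a' "\<lambda>a. ?d a (\<mu> a)"]
        by simp
      finally show ?thesis .
    qed
    ultimately show ?thesis by blast
  qed
qed

section \<open>Average cost of random serial dictatorship\<close>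

definition prefs_sorted :: "(point \<Rightarrow> point \<Rightarrow> real) \<Rightarrow> (nat \<times> nat list) list \<Rightarrow> bool" where
  "prefs_sorted d R \<longleftrightarrow> (\<forall>(i, ps)\<in>set R. sorted_wrt (\<lambda>b c. d (Agent i) (Item b) \<le> d (Agent i) (Item c)) ps)"

lemma prefs_sorted_remove_pair: "prefs_sorted d R \<Longrightarrow> prefs_sorted d (remove_pair i b R)"
  by (fastforce simp: prefs_sorted_def set_remove_pair intro: sorted_wrt_filter)

lemma sum_list_state:
  "is_state R I \<Longrightarrow> (\<Sum>(i, ps)\<leftarrow>R. (f i :: real)) = (\<Sum>i\<in>fst ` set R. f i)"
  using sum_list_distinct_conv_sum_set[of "map fst R" f]
  by (simp add: is_state_def split_def comp_def)

lemma sum_list_map_concat: "(\<Sum>x\<leftarrow>concat xss. f x) = (\<Sum>xs\<leftarrow>xss. \<Sum>x\<leftarrow>xs. f x)"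
  by (induction xss) auto

text \<open>
  A step of random serial dictatorship on \<open>r\<close> remaining agents costs at most \<open>1 / r\<close> times the
  optimum in expectation, and raises the optimum of the rest by at most its cost.
\<close>

theorem dictator_runs_cost:
  assumes m: "is_metric n d" and "is_state R I" "prefs_sorted d R" "card I = length R" "k \<le> length R"
    and "fst ` set R \<subseteq> {..<n}" "I \<subseteq> {..<n}" "bij_betw \<mu> (fst ` set R) I"
  shows "(\<Sum>M\<leftarrow>runs False k R acc. \<Sum>e\<leftarrow>M. dist_of d e) \<le> num_orders (length R) k *
    (k / (real (length R) - k + 1) * (\<Sum>a\<in>fst ` set R. d (Agent a) (Item (\<mu> a))) + (\<Sum>e\<leftarrow>acc. dist_of d e))"
  using assms(2-)
proof (induction k arbitrary: R I \<mu> acc)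
  case (Suc k)
  define r where "r = length R"
  \<comment> \<open>The reduced state has \<open>r - 1\<close> agents, so the denominator for
    \<open>k\<close> steps there equals the one claimed for \<open>Suc k\<close> steps here: both
    are \<open>q\<close>.\<close>
  define q where "q = real r - k"
  define C where "C = (\<Sum>a\<in>fst ` set R. d (Agent a) (Item (\<mu> a)))"
  define c where "c = (\<Sum>e\<leftarrow>acc. dist_of d e)"
  define N where "N = real (num_orders (r - 1) k)"
  have rk: "Suc k \<le> r" using Suc.prems by (simp add: r_def)
  have q: "1 \<le> q" using rk by (simp add: q_def)
  have I: "I \<noteq> {}" using Suc.prems rk by (auto simp: r_def)
  have step: "(\<Sum>M\<leftarrow>runs False k (remove_pair i (hd ps) R) ((i, hd ps) # acc). \<Sum>e\<leftarrow>M. dist_of d e)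
      \<le> N * (k / q * (C + d (Agent i) (Item (\<mu> i))) + d (Agent i) (Item (\<mu> i)) + c)"
    if ips: "(i, ps) \<in> set R" for i ps
  proof -
    let ?b = "hd ps" let ?R = "remove_pair i (hd ps) R"
    have iA: "i \<in> fst ` set R" using ips by force
    have ps: "set ps = I" "ps \<noteq> []" using ips I Suc.prems(1) by (auto simp: is_state_def)
    then have bI: "?b \<in> I" by auto
    have "\<mu> i \<in> set ps" using iA ps Suc.prems(7) by (auto simp: bij_betw_def)
    \<comment> \<open>The item \<open>\<mu> i\<close> is still available, so the favourite remaining
      item of \<open>i\<close> is no farther away.\<close>
    then have D: "d (Agent i) (Item ?b) \<le> d (Agent i) (Item (\<mu> i))"
      using ips ps Suc.prems(2) by (cases ps) (fastforce simp: prefs_sorted_def)+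
    obtain \<mu>' where \<mu>': "bij_betw \<mu>' (fst ` set R - {i}) (I - {?b})"
      "(\<Sum>a\<in>fst ` set R - {i}. d (Agent a) (Item (\<mu>' a))) \<le> C + d (Agent i) (Item ?b)"
      using reroute_assignment[OF m Suc.prems(5-7) iA bI] unfolding C_def by blast
    have len: "length ?R = r - 1" using length_remove_pair[OF Suc.prems(1) iA] by (simp add: r_def)
    have "finite I" using Suc.prems(6) finite_subset by blast
    then have cI: "card (I - {?b}) = length ?R" using bI Suc.prems(3) len by (simp add: r_def)
    have "(\<Sum>M\<leftarrow>runs False k ?R ((i, ?b) # acc). \<Sum>e\<leftarrow>M. dist_of d e)
      \<le> num_orders (length ?R) k * (k / (real (length ?R) - k + 1) *
          (\<Sum>a\<in>fst ` set ?R. d (Agent a) (Item (\<mu>' a))) + (\<Sum>e\<leftarrow>(i, ?b) # acc. dist_of d e))"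
      by (rule Suc.IH[OF is_state_remove_pair[OF Suc.prems(1)] prefs_sorted_remove_pair[OF Suc.prems(2)] cI])
         (use rk len Suc.prems(5,6) \<mu>' in \<open>auto simp: agents_remove_pair\<close>)
    also have "\<dots> = N * (k / q * (\<Sum>a\<in>fst ` set R - {i}. d (Agent a) (Item (\<mu>' a)))
        + (d (Agent i) (Item ?b) + c))"
      using rk by (simp add: agents_remove_pair N_def q_def c_def len of_nat_diff)
    also have "\<dots> \<le> N * (k / q * (C + d (Agent i) (Item (\<mu> i))) + d (Agent i) (Item (\<mu> i)) + c)"
    proof -
      have "k / q * (\<Sum>a\<in>fst ` set R - {i}. d (Agent a) (Item (\<mu>' a)))
          \<le> k / q * (C + d (Agent i) (Item (\<mu> i)))"
        using \<mu>'(2) D q by (intro mult_left_mono) auto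
      then show ?thesis using D by (intro mult_left_mono) (auto simp: N_def)
    qed
    finally show ?thesis .
  qed
  have "(\<Sum>M\<leftarrow>runs False (Suc k) R acc. \<Sum>e\<leftarrow>M. dist_of d e)
      = (\<Sum>(i, ps)\<leftarrow>R. \<Sum>M\<leftarrow>runs False k (remove_pair i (hd ps) R) ((i, hd ps) # acc). \<Sum>e\<leftarrow>M. dist_of d e)"
    unfolding runs_dictator_Suc[OF Suc.prems(1) I]
    by (simp add: sum_list_map_concat comp_def split_def)
  also have "\<dots> \<le> (\<Sum>(i, ps)\<leftarrow>R. N * (k / q * (C + d (Agent i) (Item (\<mu> i))) + d (Agent i) (Item (\<mu> i)) + c))"
    using step by (intro sum_list_mono) auto
  also have "\<dots> = (\<Sum>i\<in>fst ` set R. N * (k / q * (C + d (Agent i) (Item (\<mu> i))) + d (Agent i) (Item (\<mu> i)) + c))"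
    by (rule sum_list_state[OF Suc.prems(1)])
  \<comment> \<open>Over all first dictators \<open>i\<close>, the distances from \<open>i\<close>
    to \<open>\<mu> i\<close> add up to \<open>C\<close> just once.\<close>
  also have "\<dots> = N * (k / q * (r * C + C) + C + r * c)"
    using length_state[OF Suc.prems(1)]
    by (simp add: sum_distrib_left[symmetric] sum_divide_distrib[symmetric] sum.distrib r_def C_def)
  \<comment> \<open>\<open>k * (r + 1) + q = r * Suc k\<close>, since
    \<open>q = r - k\<close>.\<close>
  also have "\<dots> = r * N * (Suc k / q * C + c)"
    using q by (simp add: field_simps) (simp add: q_def algebra_simps)
  finally show ?case
    using rk by (simp add: N_def r_def[symmetric] C_def[symmetric] c_def[symmetric] q_def algebra_simps)
qed simp

section \<open>The mechanism\<close>

text \<open>Cuts are bit lists: bit \<open>i\<close> is for agent \<open>i\<close>, bit \<open>n + j\<close> for item \<open>j\<close>.\<close>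

definition bit_at :: "bool list \<Rightarrow> nat \<Rightarrow> bool" where
  "bit_at S i \<longleftrightarrow> i < length S \<and> S ! i"

definition bits_crossing :: "nat \<Rightarrow> bool list \<Rightarrow> (nat \<times> nat) list \<Rightarrow> nat" where
  "bits_crossing n S L = length (filter (\<lambda>(i, j). bit_at S i \<noteq> bit_at S (n + j)) L)"

primrec bit_lists :: "nat \<Rightarrow> bool list list" where
  "bit_lists 0 = [[]]"
| "bit_lists (Suc n) = concat (map (\<lambda>S. [False # S, True # S]) (bit_lists n))"

lemma set_bit_lists: "set (bit_lists n) = {S. length S = n}"
proof (induction n)
  case (Suc n)
  show ?case
  proof (intro equalityI subsetI)
    fix S :: "bool list" assume "S \<in> {S. length S = Suc n}"
    then obtain b S' where "S = b # S'" "length S' = n" by (auto simp: length_Suc_conv)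
    then show "S \<in> set (bit_lists (Suc n))" using Suc by (cases b) auto
  qed (use Suc in auto)
qed simp

text \<open>\<open>N\<close> will be the number of runs concatenated in \<open>X\<close>. Dividing
  by it turns \<open>X\<close> into a fractional matching in which every agent and item has weight
  at most 1.\<close>

definition thin :: "nat \<Rightarrow> bool list list \<Rightarrow> nat \<Rightarrow> (nat \<times> nat) list \<Rightarrow> nat \<Rightarrow> (nat \<times> nat) list \<Rightarrow> bool" where
  "thin n Ss N X k M \<longleftrightarrow> (\<forall>S\<in>set Ss. N * bits_crossing n S M \<le> k * bits_crossing n S X)"

primrec first_thin :: "nat \<Rightarrow> bool list list \<Rightarrow> nat \<Rightarrow> (nat \<times> nat) list \<Rightarrow> nat \<Rightarrow>
    (nat \<times> nat) list list \<Rightarrow> (nat \<times> nat) list" where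
  "first_thin n Ss N X k [] = []"
| "first_thin n Ss N X k (M # Ms) = (if thin n Ss N X k M then M else first_thin n Ss N X k Ms)"

text \<open>Thinness is measured by natural numbers so that a program can reach the least value by
  counting upwards.\<close>

definition thinnest where
  "thinnest n Ss N X Ms = first_thin n Ss N X (LEAST k. \<exists>M\<in>set Ms. thin n Ss N X k M) Ms"

definition index :: "nat list list \<Rightarrow> (nat \<times> nat list) list" where
  "index P = zip [0..<length P] P"

definition dictator_runs :: "nat list list \<Rightarrow> nat \<Rightarrow> (nat \<times> nat) list list" where
  "dictator_runs P m = runs False ((length P + m + 1) div 2) (index P) []"

text \<open>The program reads an empty result of \<open>first_thin\<close> as failure, so the empty
  instance, whose only matching is empty, is split off.\<close>

definition thin_mechanism :: "nat list list \<Rightarrow> nat \<Rightarrow> (nat \<times> nat) list" where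
  "thin_mechanism P m =
    (if P = [] then []
     else thinnest (length P) (bit_lists (length P + length P)) (length (dictator_runs P m))
       (concat (dictator_runs P m)) (runs True m (index P) []))"

lemma bits_crossing_eq:
  assumes "set L \<subseteq> {..<n} \<times> {..<n}" and "length S = n + n"
  shows "bits_crossing n S L = crossing ({Agent i | i. bit_at S i} \<union> {Item j | j. bit_at S (n + j)}) L"
  unfolding bits_crossing_def crossing_def
  by (intro arg_cong[of _ _ length] filter_cong) auto

text \<open>A set \<open>U\<close> acts on these edges only through its trace on the
  \<open>2 * n\<close> points, which a bit list records.\<close>

lemma thin_iff:
  assumes M: "set M \<subseteq> {..<n} \<times> {..<n}" and X: "set X \<subseteq> {..<n} \<times> {..<n}"
  shows "thin n (bit_lists (n + n)) N X k M \<longleftrightarrow> (\<forall>U. N * crossing U M \<le> k * crossing U X)"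
proof
  assume thin: "thin n (bit_lists (n + n)) N X k M"
  show "\<forall>U. N * crossing U M \<le> k * crossing U X"
  proof
    fix U
    define S where "S = map (\<lambda>i. Agent i \<in> U) [0..<n] @ map (\<lambda>j. Item j \<in> U) [0..<n]"
    have len: "length S = n + n" by (simp add: S_def)
    have "bits_crossing n S L = crossing U L" if "set L \<subseteq> {..<n} \<times> {..<n}" for L
      unfolding bits_crossing_def crossing_def using that
      by (intro arg_cong[of _ _ length] filter_cong) (auto simp: bit_at_def S_def nth_append)
    then show "N * crossing U M \<le> k * crossing U X"
      using thin len M X by (auto simp: thin_def set_bit_lists)
  qed
qed (auto simp: thin_def set_bit_lists bits_crossing_eq[OF M] bits_crossing_eq[OF X])

lemma first_thin_some:
  assumes "\<exists>M\<in>set Ms. thin n Ss N X k M"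
  shows "first_thin n Ss N X k Ms \<in> set Ms \<and> thin n Ss N X k (first_thin n Ss N X k Ms)"
  using assms by (induction Ms) auto

lemma thinnest_thin:
  assumes "M \<in> set Ms" "thin n Ss N X k M"
  shows "thinnest n Ss N X Ms \<in> set Ms"
    and "\<exists>k'\<le>k. thin n Ss N X k' (thinnest n Ss N X Ms)"
proof -
  let ?P = "\<lambda>k. \<exists>M\<in>set Ms. thin n Ss N X k M"
  have "?P k" using assms by blast
  then have "?P (LEAST k. ?P k)" "(LEAST k. ?P k) \<le> k" by (auto intro: LeastI Least_le)
  then show "thinnest n Ss N X Ms \<in> set Ms" "\<exists>k'\<le>k. thin n Ss N X k' (thinnest n Ss N X Ms)"
    using first_thin_some[of Ms n Ss N X "LEAST k. ?P k"] by (auto simp: thinnest_def)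
qed

lemma index_state:
  assumes "is_instance n P"
  shows "is_state (index P) {..<n}" "fst ` set (index P) = {..<n}" "length (index P) = n"
proof -
  have len: "length P = n" using assms by (simp add: is_instance_def)
  have fst: "map fst (index P) = [0..<n]" by (simp add: index_def len)
  then show "fst ` set (index P) = {..<n}"
    by (metis atLeast0LessThan list.set_map set_upt)
  show "is_state (index P) {..<n}"
    unfolding is_state_def fst using assms len
    by (auto simp: index_def is_instance_def set_zip)
  show "length (index P) = n" by (simp add: index_def len)
qed

lemma index_prefs_sorted:
  assumes "consistent P d"
  shows "prefs_sorted d (index P)"
  unfolding prefs_sorted_def
proof clarify
  fix i ps assume "(i, ps) \<in> set (index P)"
  then have "i < length P" "ps = P ! i" by (auto simp: index_def set_zip)
  then show "sorted_wrt (\<lambda>b c. d (Agent i) (Item b) \<le> d (Agent i) (Item c)) ps"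
    using assms by (auto simp: consistent_def sorted_wrt_iff_nth_less)
qed

lemma target_size_bounds:
  assumes "0 < \<epsilon>" "\<epsilon> < 1" "1 \<le> n"
  shows "1 \<le> target_size \<epsilon> n" "target_size \<epsilon> n \<le> n" "real (target_size \<epsilon> n) < (1 - \<epsilon>) * n + 1"
proof -
  have pos: "0 < (1 - \<epsilon>) * n" using assms by simp
  have "(1 - \<epsilon>) * n \<le> 1 * real n" using assms by (intro mult_right_mono) auto
  then show "target_size \<epsilon> n \<le> n" by (simp add: target_size_def)
  have "0 < \<lceil>(1 - \<epsilon>) * n\<rceil>" using pos by simp
  then show "1 \<le> target_size \<epsilon> n" unfolding target_size_def by linarith
  have "real (target_size \<epsilon> n) = \<lceil>(1 - \<epsilon>) * n\<rceil>" using pos by (simp add: target_size_def)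
  then show "real (target_size \<epsilon> n) < (1 - \<epsilon>) * n + 1" using ceiling_correct[of "(1 - \<epsilon>) * n"] by simp
qed

text \<open>The reciprocal, rounded up, of the expansion
  \<open>\<phi> = \<epsilon> / (4 * log 2 (2 * n))\<close>. The 4 is chosen so that the
  decomposition of the \<open>2 * n\<close> points loses at most \<open>\<epsilon> * n / 2\<close>
  pairs.\<close>

definition thinness_bound :: "real \<Rightarrow> nat \<Rightarrow> nat" where
  "thinness_bound \<epsilon> n = nat \<lceil>4 * log 2 (2 * n) / \<epsilon>\<rceil>"

section \<open>Existence and cost of the thin matching\<close>

context
  fixes \<epsilon> :: real and n :: nat and P :: "nat list list" and m m' :: nat
  assumes eps: "0 < \<epsilon>" "\<epsilon> < 1" and n: "1 \<le> n" and P: "is_instance n P"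
  defines "m \<equiv> target_size \<epsilon> n"
  defines "m' \<equiv> (n + m + 1) div 2"
begin

lemma length_P: "length P = n"
  using P by (simp add: is_instance_def)

lemma m'_le: "m' \<le> n"
  using target_size_bounds[OF eps n] by (simp add: m'_def m_def)

lemma dictator_runs_eq: "dictator_runs P m = runs False m' (index P) []"
  by (simp add: dictator_runs_def length_P m'_def)

lemma length_dictator_runs: "length (dictator_runs P m) = num_orders n m'"
  using length_runs_dictator[OF index_state(1)[OF P], of m' "[]"] m'_le index_state(3)[OF P]
  by (simp add: dictator_runs_eq)

lemma length_dictator_runs_pos: "0 < length (dictator_runs P m)"
  using num_orders_pos[OF m'_le] by (simp add: length_dictator_runs)

lemma runs_index:
  assumes "xs \<in> set (runs fl k (index P) [])"
  shows "length xs = k" "distinct (map fst xs)" "distinct (map snd xs)" "set xs \<subseteq> {..<n} \<times> {..<n}"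
  using runs_sound[OF index_state(1)[OF P] assms] index_state(2)[OF P] by auto

lemma concat_runs_range: "set (concat (dictator_runs P m)) \<subseteq> {..<n} \<times> {..<n}"
  using runs_index(4) by (fastforce simp: dictator_runs_eq)

text \<open>Each run is a matching and contributes at most one edge at a given agent or
  item.\<close>

lemma length_filter_concat_le:
  assumes "\<And>xs. xs \<in> set xss \<Longrightarrow> distinct (map f xs)"
  shows "length (filter (\<lambda>e. f e = a) (concat xss)) \<le> length xss"
  using assms
proof (induction xss)
  case (Cons xs xss)
  have "length (filter (\<lambda>e. f e = a) xs) = length (filter (\<lambda>b. b = a) (map f xs))"
    by (simp add: filter_map comp_def)
  also have "\<dots> = card (set (filter (\<lambda>b. b = a) (map f xs)))"
    using Cons.prems by (intro distinct_card[symmetric] distinct_filter) auto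
  also have "\<dots> \<le> card {a}" by (intro card_mono) auto
  finally show ?case using Cons by (force simp: add_mono)
qed simp

text \<open>The runs have \<open>m'\<close> pairs, which exceeds \<open>m\<close> by half the slack
  up to rounding. The decomposition loses at most \<open>\<epsilon> * n / 2\<close> pairs, so more
  than \<open>m - 1\<close> remain, and integrality gives \<open>m\<close>.\<close>

lemma ex_thin_run:
  "\<exists>M\<in>set (runs True m (index P) []). thin n (bit_lists (n + n)) (length (dictator_runs P m))
     (concat (dictator_runs P m)) (thinness_bound \<epsilon> n) M"
proof -
  let ?W = "dictator_runs P m" let ?X = "concat (dictator_runs P m)"
  define N where "N = length ?W"
  define lg where "lg = log 2 (2 * real n)"
  define \<phi> where "\<phi> = \<epsilon> / (4 * lg)"
  have lg: "1 \<le> lg" using n by (simp add: lg_def)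
  have \<phi>: "0 < \<phi>" using eps lg by (simp add: \<phi>_def)
  have N: "0 < N" using length_dictator_runs_pos by (simp add: N_def)
  have deg: "length (filter (\<lambda>e. fst e = a) ?X) \<le> N" "length (filter (\<lambda>e. snd e = a) ?X) \<le> N" for a
    unfolding N_def by (intro length_filter_concat_le; use runs_index in \<open>simp add: dictator_runs_eq\<close>)+
  have all: "filter (inside (points n)) ?X = ?X"
    using concat_runs_range by (intro filter_True) (auto simp: inside_def points_def)
  obtain M where M: "M \<subseteq> {e. inside (points n) e}" "inj_on fst M" "inj_on snd M"
    "\<And>U. \<phi> * N * card {e \<in> M. separates U e} \<le> crossing U ?X"
    "length ?X - \<phi> * N * (2 * n * lg) \<le> N * card M"
    using ex_thin_matching[OF finite_points less_imp_le[OF \<phi>] deg, of n] unfolding all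
    by (auto simp: card_points lg_def)
  have Mn: "M \<subseteq> {..<n} \<times> {..<n}" using M(1) by (auto simp: inside_def points_def)
  have finM: "finite M" using Mn finite_subset by blast
  have lX: "length ?X = N * m'"
    using runs_index(1) by (simp add: length_concat N_def dictator_runs_eq sum_list_triv cong: map_cong)
  have loss: "\<phi> * N * (2 * n * lg) = N * (\<epsilon> * n / 2)" using lg by (simp add: \<phi>_def)
  have "N * (m' - \<epsilon> * n / 2) \<le> N * card M"
    using M(5) unfolding lX loss by (simp add: right_diff_distrib)
  then have "m' - \<epsilon> * n / 2 \<le> card M" using N by simp
  moreover have "real m' \<ge> (real n + m) / 2" by (simp add: m'_def)
  moreover have "real m < (1 - \<epsilon>) * n + 1" using target_size_bounds[OF eps n] by (simp add: m_def)
  ultimately have "real m < card M + 1" by (simp add: algebra_simps)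
  then have "m \<le> card M" by simp
  \<comment> \<open>Discarding pairs can only lower crossing numbers, so the size may be cut down to
    exactly \<open>m\<close>.\<close>
  then obtain M0 where M0: "M0 \<subseteq> M" "card M0 = m" by (meson obtain_subset_with_card_n)
  have fin0: "finite M0" using M0 finM finite_subset by blast
  obtain xs where xs: "xs \<in> set (runs True m (index P) [])" "set xs = M0"
    using runs_complete[OF index_state(1)[OF P] fin0 inj_on_subset[OF M(2) M0(1)]
        inj_on_subset[OF M(3) M0(1)] _ M0(2), of "[]"] M0(1) Mn index_state(2)[OF P]
    by auto
  have "distinct xs" using runs_index(2)[OF xs(1)] by (simp add: distinct_map)
  then have cross: "crossing U xs = card {e \<in> M0. separates U e}" for U
    unfolding crossing_def xs(2)[symmetric]
    by (metis distinct_card distinct_filter set_filter)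
  have "N * crossing U xs \<le> thinness_bound \<epsilon> n * crossing U ?X" for U
  proof -
    have "\<phi> * (N * card {e \<in> M0. separates U e}) \<le> \<phi> * N * card {e \<in> M. separates U e}"
      using \<phi> M0 finM by (auto simp: mult.assoc intro!: mult_left_mono card_mono)
    also have "\<dots> \<le> crossing U ?X" by (rule M(4))
    finally have "N * card {e \<in> M0. separates U e} \<le> 1 / \<phi> * crossing U ?X"
      using \<phi> by (simp add: field_simps)
    also have "\<dots> \<le> thinness_bound \<epsilon> n * crossing U ?X"
      unfolding of_nat_mult \<phi>_def thinness_bound_def lg_def
      by (intro mult_right_mono) (simp_all add: of_nat_ceiling)
    finally show ?thesis by (simp add: cross flip: of_nat_mult)
  qed
  then show ?thesis
    using xs thin_iff[OF runs_index(4)[OF xs(1)] concat_runs_range] unfolding N_def by blast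
qed

lemma thin_mechanism_eq:
  "thin_mechanism P m = thinnest n (bit_lists (n + n)) (length (dictator_runs P m))
     (concat (dictator_runs P m)) (runs True m (index P) [])"
  using length_P n by (auto simp: thin_mechanism_def)

lemma thin_mechanism_in_runs: "thin_mechanism P m \<in> set (runs True m (index P) [])"
  using ex_thin_run thinnest_thin(1) unfolding thin_mechanism_eq by blast

lemma thin_mechanism_matching:
  "is_matching n (set (thin_mechanism P m))" "card (set (thin_mechanism P m)) = m"
  "distinct (thin_mechanism P m)"
proof -
  note r = runs_index[OF thin_mechanism_in_runs]
  show "is_matching n (set (thin_mechanism P m))"
    using r by (simp add: is_matching_def distinct_map)
  show "distinct (thin_mechanism P m)" using r(2) by (simp add: distinct_map)
  then show "card (set (thin_mechanism P m)) = m" using r(1) by (simp add: distinct_card)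
qed

lemma perfect_matching_assignment:
  assumes "is_perfect_matching n M"
  obtains \<mu> where "bij_betw \<mu> {..<n} {..<n}" "cost d M = (\<Sum>a<n. d (Agent a) (Item (\<mu> a)))"
proof -
  have M: "M \<subseteq> {..<n} \<times> {..<n}" "inj_on fst M" "inj_on snd M" "card M = n"
    using assms by (auto simp: is_perfect_matching_def is_matching_def)
  have fst: "fst ` M = {..<n}"
    using M by (intro card_subset_eq) (auto simp: card_image)
  have snd: "snd ` M = {..<n}"
    using M by (intro card_subset_eq) (auto simp: card_image)
  define \<mu> where "\<mu> = snd \<circ> the_inv_into M fst"
  have \<mu>: "\<mu> (fst e) = snd e" if "e \<in> M" for e
    using that M(2) by (simp add: \<mu>_def the_inv_into_f_f)
  have "bij_betw \<mu> {..<n} {..<n}"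
    unfolding \<mu>_def
    using M fst snd by (intro bij_betw_trans[of _ _ M] bij_betw_the_inv_into) (auto simp: bij_betw_def)
  moreover have "cost d M = (\<Sum>a<n. d (Agent a) (Item (\<mu> a)))"
    unfolding cost_def fst[symmetric] sum.reindex[OF M(2)] by (rule sum.cong) (auto dest: \<mu>)
  ultimately show ?thesis by (rule that)
qed

lemma cost_set: "distinct xs \<Longrightarrow> cost d (set xs) = (\<Sum>e\<leftarrow>xs. dist_of d e)"
  by (simp add: cost_def sum_list_distinct_conv_sum_set split_def dist_of_endpoints)

lemma thin_mechanism_cost:
  assumes m: "is_metric n d" and con: "consistent P d" and opt: "is_perfect_matching n Mopt"
  shows "cost d (set (thin_mechanism P m))
    \<le> 24 * (log 2 (2 * n) + 1) * thinness_bound \<epsilon> n * (2 / \<epsilon>) * cost d Mopt"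
proof -
  let ?X = "concat (dictator_runs P m)" let ?out = "thin_mechanism P m"
  define N where "N = length (dictator_runs P m)"
  define lg where "lg = log 2 (2 * real n)"
  \<comment> \<open>The least natural number above \<open>lg\<close>, which makes
    \<open>2 * n < 2 ^ T\<close>.\<close>
  define T where "T = nat \<lfloor>lg\<rfloor> + 1"
  have lg: "0 \<le> lg" using n by (simp add: lg_def)
  have N: "0 < N" using length_dictator_runs_pos by (simp add: N_def)
  have T: "lg < T" "T \<le> lg + 1" using lg by (auto simp: T_def) linarith+
  have "2 * real n = 2 powr lg" using n by (simp add: lg_def)
  also have "\<dots> < 2 powr T" using T by simp
  finally have "real (2 * n) < real (2 ^ T)" by (simp add: powr_realpow)
  then have T2: "2 * n < 2 ^ T" by (simp only: of_nat_less_iff)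
  obtain \<mu> where \<mu>: "bij_betw \<mu> {..<n} {..<n}" "cost d Mopt = (\<Sum>a<n. d (Agent a) (Item (\<mu> a)))"
    using perfect_matching_assignment[OF opt] by blast
  have c0: "0 \<le> cost d Mopt"
    unfolding \<mu>(2)
  proof (rule sum_nonneg)
    fix a assume "a \<in> {..<n}"
    then have "Agent a \<in> points n" "Item (\<mu> a) \<in> points n"
      using \<mu>(1) by (auto simp: points_def bij_betw_def)
    then show "0 \<le> d (Agent a) (Item (\<mu> a))" using m by (auto simp: is_metric_def)
  qed
  \<comment> \<open>The mechanism attains the least thinness, which is at most the one known to be
    attainable.\<close>
  obtain k where k: "k \<le> thinness_bound \<epsilon> n" "thin n (bit_lists (n + n)) N ?X k ?out"
    using ex_thin_run thinnest_thin(2) unfolding thin_mechanism_eq N_def by blast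
  have out: "set ?out \<subseteq> {..<n} \<times> {..<n}" by (rule runs_index(4)[OF thin_mechanism_in_runs])
  have dom: "real N * crossing U ?out \<le> real k * crossing U ?X" for U
    using k(2) unfolding thin_iff[OF out concat_runs_range] by (metis of_nat_le_iff of_nat_mult)
  have "(\<Sum>e\<leftarrow>?X. dist_of d e) \<le> N * (m' / (real n - m' + 1) * cost d Mopt)"
    using dictator_runs_cost[OF m index_state(1)[OF P] index_prefs_sorted[OF con], of m' \<mu> "[]"]
      m'_le \<mu> index_state[OF P]
    by (simp add: dictator_runs_eq[symmetric] sum_list_map_concat length_dictator_runs N_def)
  also have "\<dots> \<le> N * (2 / \<epsilon> * cost d Mopt)"
  proof -
    have "real m' \<le> (real n + m + 1) / 2" 
    proof -
      have "2 * m' \<le> n + m + 1" unfolding m'_def by simp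
      then have "real (2 * m') \<le> real (n + m + 1)" by (simp only: of_nat_le_iff)
      then show ?thesis by simp
    qed
    moreover have "real m < (1 - \<epsilon>) * n + 1" using target_size_bounds[OF eps n] by (simp add: m_def)
    \<comment> \<open>About half of the slack stays unserved after \<open>m'\<close> steps. The
      denominator of the cost ratio is therefore linear in \<open>n\<close>, and the ratio is at
      most \<open>2 / \<epsilon>\<close>.\<close>
    ultimately have q: "\<epsilon> * n / 2 \<le> real n - m' + 1" by (simp add: algebra_simps)
    have "m' / (real n - m' + 1) \<le> n / (\<epsilon> * n / 2)"
      using m'_le q eps n by (intro frac_le) auto
    then show ?thesis using n eps c0 by (intro mult_left_mono mult_right_mono) auto
  qed
  finally have X: "(\<Sum>e\<leftarrow>?X. dist_of d e) \<le> N * (2 / \<epsilon> * cost d Mopt)" .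
  have "N * cost d (set ?out) \<le> 24 * T * k * (\<Sum>e\<leftarrow>?X. dist_of d e)"
    using cut_dominated_length[OF m T2 out concat_runs_range _ _ dom]
    by (simp add: cost_set thin_mechanism_matching)
  also have "\<dots> \<le> 24 * T * k * (N * (2 / \<epsilon> * cost d Mopt))"
    using X by (intro mult_left_mono) auto
  also have "\<dots> \<le> 24 * (lg + 1) * thinness_bound \<epsilon> n * (N * (2 / \<epsilon> * cost d Mopt))"
  proof -
    have "24 * real T \<le> 24 * (lg + 1)" "real k \<le> thinness_bound \<epsilon> n" using T k by auto
    then have "24 * real T * k \<le> 24 * (lg + 1) * thinness_bound \<epsilon> n"
      using lg by (intro mult_mono) auto
    then show ?thesis using eps c0 by (intro mult_right_mono) auto
  qed
  finally have "N * cost d (set ?out)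
      \<le> N * (24 * (lg + 1) * thinness_bound \<epsilon> n * (2 / \<epsilon>) * cost d Mopt)"
    by (simp add: mult_ac)
  then have "cost d (set ?out) \<le> 24 * (lg + 1) * thinness_bound \<epsilon> n * (2 / \<epsilon>) * cost d Mopt"
    by (rule mult_left_le_imp_le) (use N in simp)
  then show ?thesis by (simp add: lg_def)
qed

end

text \<open>With \<open>x = log 2 n \<ge> 1\<close>, the logarithmic factor is at most
  \<open>3 * x\<close> and the thinness at most \<open>9 * x / \<epsilon>\<close>. The constant is
  \<open>24 * 3 * 9 * 2 = 1296\<close>, and \<open>(ln 2)\<^sup>2\<close> comes from the change of
  base.\<close>

lemma polylog_bound:
  assumes "0 < \<epsilon>" "\<epsilon> < 1" "2 \<le> n"
  shows "24 * (log 2 (real (2 * n)) + 1) * thinness_bound \<epsilon> n * (2 / \<epsilon>)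
    \<le> 1296 / (\<epsilon>\<^sup>2 * (ln 2)\<^sup>2) * (ln (real n))\<^sup>2"
proof -
  define x where "x = log 2 (real n)"
  have x: "1 \<le> x" using assms by (simp add: x_def)
  have lg: "log 2 (2 * real n) = 1 + x" using assms by (simp add: x_def log_mult)
  have "real (thinness_bound \<epsilon> n) \<le> 4 * (1 + x) / \<epsilon> + 1"
    using x assms ceiling_correct[of "4 * (1 + x) / \<epsilon>"] by (simp add: thinness_bound_def lg)
  also have "\<dots> \<le> 4 * (2 * x) / \<epsilon> + x / \<epsilon>"
    using x assms by (intro add_mono divide_right_mono) (auto simp: field_simps intro: order_trans[of _ 1])
  finally have "real (thinness_bound \<epsilon> n) \<le> 9 * x / \<epsilon>" by (simp add: field_simps)
  then have "24 * (log 2 (real (2 * n)) + 1) * thinness_bound \<epsilon> n * (2 / \<epsilon>) \<le> 24 * (3 * x) * (9 * x / \<epsilon>) * (2 / \<epsilon>)"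
    using x assms lg by (intro mult_mono mult_right_mono) auto
  also have "\<dots> = 1296 / (\<epsilon>\<^sup>2 * (ln 2)\<^sup>2) * (ln (real n))\<^sup>2"
    by (simp add: x_def log_def power2_eq_square)
  finally show ?thesis by simp
qed

section \<open>The program\<close>

definition ev :: "expr list \<Rightarrow> data list \<Rightarrow> expr \<Rightarrow> data \<Rightarrow> nat \<Rightarrow> bool" where
  "ev fs env e v b \<longleftrightarrow> (\<exists>t\<le>b. evaluates fs env e v t)"

definition evs :: "expr list \<Rightarrow> data list \<Rightarrow> expr list \<Rightarrow> data list \<Rightarrow> nat \<Rightarrow> bool" where
  "evs fs env es vs b \<longleftrightarrow> (\<exists>t\<le>b. evaluates_list fs env es vs t)"

lemma ev_EVar: "i < length env \<Longrightarrow> env ! i = v \<Longrightarrow> ev fs env (EVar i) v 1"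
  unfolding ev_def using evaluates_evaluates_list.Var by blast

lemma ev_EAtom: "ev fs env EAtom Atom 1"
  unfolding ev_def using evaluates_evaluates_list.Atom by blast

lemma ev_ECons: "ev fs env e1 v1 b1 \<Longrightarrow> ev fs env e2 v2 b2 \<Longrightarrow> ev fs env (ECons e1 e2) (Cell v1 v2) (b1 + b2 + 1)"
  unfolding ev_def by (meson evaluates_evaluates_list.Cons add_mono le_refl)

lemma ev_ECar: "ev fs env e u b \<Longrightarrow> car u = v \<Longrightarrow> ev fs env (ECar e) v (b + 1)"
  unfolding ev_def by (metis evaluates_evaluates_list.Car add_le_mono1)

lemma ev_ECdr: "ev fs env e u b \<Longrightarrow> cdr u = v \<Longrightarrow> ev fs env (ECdr e) v (b + 1)"
  unfolding ev_def by (metis evaluates_evaluates_list.Cdr add_le_mono1)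

text \<open>The branch is selected inside the premise, once the value \<open>u\<close> of the
  condition is known, so one rule serves for symbolic execution of both branches.\<close>

lemma ev_EIf:
  assumes "ev fs env e u b1" "ev fs env (if u = Atom then e2 else e1) v b2"
  shows "ev fs env (EIf e e1 e2) v (b1 + b2 + 1)"
proof -
  obtain t1 t2 where t: "t1 \<le> b1" "evaluates fs env e u t1"
    "t2 \<le> b2" "evaluates fs env (if u = Atom then e2 else e1) v t2"
    using assms by (auto simp: ev_def)
  have "evaluates fs env (EIf e e1 e2) v (t1 + t2 + 1)"
    using t IfT[of fs env e u t1 e1 v t2 e2] IfF[of fs env e t1 e2 v t2 e1]
    by (cases "u = Atom") simp_all
  then show ?thesis using t unfolding ev_def by (intro exI[of _ "t1 + t2 + 1"]) auto
qed

lemma ev_ECall: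
  "evs fs env es vs b1 \<Longrightarrow> g < length fs \<Longrightarrow> ev fs vs (fs ! g) v b2 \<Longrightarrow> ev fs env (ECall g es) v (b1 + b2 + 1)"
  unfolding ev_def evs_def by (meson evaluates_evaluates_list.Call add_mono le_refl)

lemma evs_Nil: "evs fs env [] [] 0"
  unfolding evs_def using evaluates_evaluates_list.Nil by blast

lemma evs_Cons: "ev fs env e v b1 \<Longrightarrow> evs fs env es vs b2 \<Longrightarrow> evs fs env (e # es) (v # vs) (b1 + b2)"
  unfolding ev_def evs_def by (meson evaluates_evaluates_list.More add_mono)

lemma ev_mono: "ev fs env e u b \<Longrightarrow> u = v \<Longrightarrow> b \<le> c \<Longrightarrow> ev fs env e v c"
  unfolding ev_def by (meson le_trans)

section \<open>The Lisp program\<close>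

abbreviation ETrue :: expr where
  "ETrue \<equiv> ECons EAtom EAtom"

text \<open>The recursive call of function 10, which occurs four times in its body.\<close>

definition rec_cnt :: expr where
  "rec_cnt = ECall 10 [EVar 0, EVar 1, ECdr (EVar 2), EVar 3]"

text \<open>The constants of a rational target size \<open>\<lceil>p * n / q\<rceil>\<close> are
  unrolled into the program text: \<open>cdrs q\<close> subtracts \<open>q\<close> from a unary
  number, stopping at zero, and \<open>copies p\<close> multiplies by \<open>p\<close>.\<close>

primrec cdrs :: "nat \<Rightarrow> expr" where
  "cdrs 0 = EVar 0"
| "cdrs (Suc q) = ECdr (cdrs q)"

primrec copies :: "nat \<Rightarrow> expr" where
  "copies 0 = EAtom"
| "copies (Suc p) = ECall 2 [EVar 0, copies p]"

text \<open>
  Functions 0 to 21, in the order of their call numbers: the entry point, rounded up division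
  by \<open>q\<close>, append, equality, removal of an item from a list, \<open>remove_pair\<close>, \<open>runs\<close> (three functions), bit lookup, weighted crossing number, concatenation,
  comparison of lengths, \<open>bit_lists\<close> (two functions), \<open>thin\<close>, \<open>first_thin\<close>, search for the least
  thinness, halving, \<open>index\<close>, and \<open>thin_mechanism\<close> (two functions).
\<close>

definition prog :: "expr \<Rightarrow> nat \<Rightarrow> expr list" where
  "prog entry q = [
    entry,
    EIf (EVar 0) (ECons EAtom (ECall 1 [cdrs q])) EAtom,
    EIf (EVar 0) (ECons (ECar (EVar 0)) (ECall 2 [ECdr (EVar 0), EVar 1])) (EVar 1),
    EIf (EVar 0) (EIf (EVar 1) (ECall 3 [ECdr (EVar 0), ECdr (EVar 1)]) EAtom)
      (EIf (EVar 1) EAtom ETrue),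
    EIf (EVar 1)
      (EIf (ECall 3 [EVar 0, ECar (EVar 1)])
        (ECall 4 [EVar 0, ECdr (EVar 1)])
        (ECons (ECar (EVar 1)) (ECall 4 [EVar 0, ECdr (EVar 1)])))
      EAtom,
    EIf (EVar 2)
      (EIf (ECall 3 [EVar 0, ECar (ECar (EVar 2))])
        (ECall 5 [EVar 0, EVar 1, ECdr (EVar 2)])
        (ECons (ECons (ECar (ECar (EVar 2))) (ECall 4 [EVar 1, ECdr (ECar (EVar 2))]))
          (ECall 5 [EVar 0, EVar 1, ECdr (EVar 2)])))
      EAtom,
    EIf (EVar 0) (ECall 7 [ECdr (EVar 0), EVar 1, EVar 1, EVar 2, EVar 3]) (ECons (EVar 3) EAtom),
    EIf (EVar 1)
      (ECall 2 [ECall 8 [EVar 0,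
          EIf (EVar 3) (ECdr (ECar (EVar 1)))
            (EIf (ECdr (ECar (EVar 1))) (ECons (ECar (ECdr (ECar (EVar 1)))) EAtom) EAtom),
          ECar (ECar (EVar 1)), EVar 2, EVar 3, EVar 4],
        ECall 7 [EVar 0, ECdr (EVar 1), EVar 2, EVar 3, EVar 4]])
      EAtom,
    EIf (EVar 1)
      (ECall 2 [ECall 6 [EVar 0, ECall 5 [EVar 2, ECar (EVar 1), EVar 3], EVar 4,
          ECons (ECons (EVar 2) (ECar (EVar 1))) (EVar 5)],
        ECall 8 [EVar 0, ECdr (EVar 1), EVar 2, EVar 3, EVar 4, EVar 5]])
      EAtom,
    EIf (EVar 1) (ECall 9 [ECdr (EVar 0), ECdr (EVar 1)]) (ECar (EVar 0)),
    EIf (EVar 2)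
      (EIf (ECall 9 [EVar 0, ECar (ECar (EVar 2))])
        (EIf (ECall 9 [EVar 0, ECall 2 [EVar 1, ECdr (ECar (EVar 2))]])
          rec_cnt (ECall 2 [EVar 3, rec_cnt]))
        (EIf (ECall 9 [EVar 0, ECall 2 [EVar 1, ECdr (ECar (EVar 2))]])
          (ECall 2 [EVar 3, rec_cnt]) rec_cnt))
      EAtom,
    EIf (EVar 0) (ECall 2 [ECar (EVar 0), ECall 11 [ECdr (EVar 0)]]) EAtom,
    EIf (EVar 0) (EIf (EVar 1) (ECall 12 [ECdr (EVar 0), ECdr (EVar 1)]) EAtom) ETrue,
    EIf (EVar 0) (ECall 14 [ECall 13 [ECdr (EVar 0)]]) ETrue,
    EIf (EVar 0)
      (ECons (ECons EAtom (ECar (EVar 0)))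
        (ECons (ECons ETrue (ECar (EVar 0))) (ECall 14 [ECdr (EVar 0)])))
      EAtom,
    EIf (EVar 0)
      (EIf (ECall 12 [ECall 10 [ECar (EVar 0), EVar 1, EVar 2, EVar 3],
                      ECall 10 [ECar (EVar 0), EVar 1, EVar 4, EVar 5]])
        (ECall 15 [ECdr (EVar 0), EVar 1, EVar 2, EVar 3, EVar 4, EVar 5])
        EAtom)
      ETrue,
    EIf (EVar 0)
      (EIf (ECall 15 [EVar 1, EVar 2, ECar (EVar 0), EVar 3, EVar 4, EVar 5])
        (ECar (EVar 0))
        (ECall 16 [ECdr (EVar 0), EVar 1, EVar 2, EVar 3, EVar 4, EVar 5]))
      EAtom,
    EIf (ECall 16 [EVar 0, EVar 1, EVar 2, EVar 3, EVar 4, EVar 5])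
      (ECall 16 [EVar 0, EVar 1, EVar 2, EVar 3, EVar 4, EVar 5])
      (ECall 17 [EVar 0, EVar 1, EVar 2, EVar 3, EVar 4, ECons EAtom (EVar 5)]),
    EIf (EVar 0) (ECons EAtom (ECall 18 [ECdr (ECdr (EVar 0))])) EAtom,
    EIf (EVar 0)
      (ECons (ECons (EVar 1) (ECar (EVar 0))) (ECall 19 [ECdr (EVar 0), ECons EAtom (EVar 1)]))
      EAtom,
    EIf (EVar 0)
      (ECall 21 [ECall 6 [EVar 1, ECall 19 [EVar 0, EAtom], ETrue, EAtom],
        ECall 13 [ECall 2 [EVar 0, EVar 0]], EVar 0,
        ECall 6 [ECall 18 [ECall 2 [EVar 0, EVar 1]], ECall 19 [EVar 0, EAtom], EAtom, EAtom]])
      EAtom,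
    ECall 17 [EVar 0, EVar 1, EVar 2, EVar 3, ECall 11 [EVar 3], EAtom]]"

text \<open>Numbers are read off the spine of a tree, whatever its heads are. Any list thus serves
  as the unary number of its length: the instance itself stands for \<open>n\<close>, and the list
  of runs for their number \<open>N\<close>.\<close>

fun len :: "data \<Rightarrow> nat" where
  "len Atom = 0"
| "len (Cell u v) = Suc (len v)"

fun dapp :: "data \<Rightarrow> data \<Rightarrow> data" where
  "dapp Atom y = y"
| "dapp (Cell u v) y = Cell u (dapp v y)"

primrec drep :: "nat \<Rightarrow> data \<Rightarrow> data" where
  "drep 0 w = Atom"
| "drep (Suc j) w = dapp w (drep j w)"

definition enc_bool :: "bool \<Rightarrow> data" where
  "enc_bool b = (if b then Cell Atom Atom else Atom)"

definition enc_entry :: "nat \<times> nat list \<Rightarrow> data" where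
  "enc_entry p = Cell (enc_nat (fst p)) (enc_list enc_nat (snd p))"

lemma enc_bool_simps [simp]: "enc_bool True = Cell Atom Atom" "enc_bool False = Atom"
  by (simp_all add: enc_bool_def)

lemma enc_entry_simp [simp]: "enc_entry (i, ps) = Cell (enc_nat i) (enc_list enc_nat ps)"
  by (simp add: enc_entry_def)

lemma enc_pair_simp [simp]: "enc_pair (i, j) = Cell (enc_nat i) (enc_nat j)"
  by (simp add: enc_pair_def)

lemma len_dapp [simp]: "len (dapp x y) = len x + len y"
  by (induction x) auto

lemma len_drep [simp]: "len (drep j w) = j * len w"
  by (induction j) auto

lemma len_enc_nat [simp]: "len (enc_nat i) = i"
  by (induction i) auto

lemma len_enc_list [simp]: "len (enc_list f xs) = length xs"
  by (induction xs) auto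

lemma dapp_enc_list [simp]: "dapp (enc_list f xs) (enc_list f ys) = enc_list f (xs @ ys)"
  by (induction xs) auto

lemma enc_list_eq_Atom [simp]: "enc_list f xs = Atom \<longleftrightarrow> xs = []"
  by (cases xs) auto

section \<open>Values and running times of the list functions\<close>

definition remove_pair_time :: "nat \<Rightarrow> nat" where
  "remove_pair_time n = 10 * n + 100 + (10 * n + 50) * (n + 1)"

text \<open>Two programs are needed, one that reads the target size and one that computes it. They
  differ only in \<open>entry\<close> and \<open>q\<close>, so fixing these lets both share the
  function lemmas.\<close>

locale lisp_program =
  fixes entry :: expr and q :: nat
begin

definition fn :: "nat \<Rightarrow> data list \<Rightarrow> data \<Rightarrow> nat \<Rightarrow> bool" where
  "fn g args v b \<longleftrightarrow> ev (prog entry q) args (prog entry q ! g) v b"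

lemma length_prog: "length (prog entry q) = 22"
  by (simp add: prog_def)

text \<open>The value \<open>u\<close> and the cost \<open>c\<close> stay schematic while the
  evaluation rules execute the body; then \<open>u = v\<close> and \<open>c \<le> b\<close> remain.
  All function lemmas below follow this pattern.\<close>

lemma fnI:
  "prog entry q ! g = e \<Longrightarrow> ev (prog entry q) args e u c \<Longrightarrow> u = v \<Longrightarrow> c \<le> b \<Longrightarrow> fn g args v b"
  unfolding fn_def by (metis ev_mono)

lemma ev_call:
  "evs (prog entry q) env es vs b1 \<Longrightarrow> g < 22 \<Longrightarrow> fn g vs v b2 \<Longrightarrow>
    ev (prog entry q) env (ECall g es) v (b1 + b2 + 1)"
  unfolding fn_def by (rule ev_ECall) (simp_all add: length_prog)

lemmas ev_rules = ev_EVar ev_EAtom ev_ECons ev_ECar ev_ECdr ev_EIf ev_call evs_Nil evs_Cons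

lemma fn_append: "fn 2 [x, y] (dapp x y) (10 * len x + 10)"
proof (induction x)
  case Atom
  show ?case
    by (rule fnI, simp add: prog_def) (rule ev_rules | simp)+
next
  case (Cell u x)
  show ?case
    by (rule fnI, simp add: prog_def) (rule ev_rules Cell.IH | simp)+
qed

lemma fn_eq: "fn 3 [enc_nat i, enc_nat j] (enc_bool (i = j)) (10 * i + 10)"
proof (induction i arbitrary: j)
  case 0
  show ?case
    by (cases j; rule fnI, simp add: prog_def, (rule ev_rules | simp)+)
next
  case (Suc i)
  show ?case
    by (cases j; rule fnI, simp add: prog_def, (rule ev_rules Suc.IH | simp)+)
qed

lemma fn_remove:
  "fn 4 [enc_nat b, enc_list enc_nat cs] (enc_list enc_nat (filter (\<lambda>c. c \<noteq> b) cs))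
    ((10 * b + 50) * (length cs + 1))"
proof (induction cs)
  case Nil
  show ?case
    by (rule fnI, simp add: prog_def) (rule ev_rules | simp)+
next
  case (Cons c cs)
  show ?case
  proof (cases "c = b")
    case True
    show ?thesis unfolding True
      by (rule fnI, simp add: prog_def) (rule ev_rules Cons.IH fn_eq | simp)+
  next
    case False
    then have "b \<noteq> c" by simp
    then show ?thesis
      apply (intro fnI, simp add: prog_def)
      by (rule ev_rules Cons.IH fn_eq | simp)+
  qed
qed

lemma fn_remove_pair:
  assumes "i \<le> n" "b \<le> n" "\<And>j qs. (j, qs) \<in> set R \<Longrightarrow> length qs \<le> n"
  shows "fn 5 [enc_nat i, enc_nat b, enc_list enc_entry R] (enc_list enc_entry (remove_pair i b R))
    (remove_pair_time n * (length R + 1))"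
  using assms(3)
proof (induction R)
  case Nil
  show ?case
    by (rule fnI, simp add: prog_def) (rule ev_rules | simp add: remove_pair_def remove_pair_time_def)+
next
  case (Cons p R)
  obtain j qs where p: "p = (j, qs)" by (cases p)
  have IH: "fn 5 [enc_nat i, enc_nat b, enc_list enc_entry R] (enc_list enc_entry (remove_pair i b R))
    (remove_pair_time n * (length R + 1))"
    using Cons by auto
  have "length qs \<le> n" using Cons.prems p by auto
  then have "(10 * b + 50) * (length qs + 1) \<le> (10 * n + 50) * (n + 1)"
    using assms by (intro mult_mono) auto
  then have t: "10 * i + 90 + (10 * b + 50) * (length qs + 1) + remove_pair_time n * (length R + 1)
      \<le> remove_pair_time n * (length (p # R) + 1)"
    using assms by (simp add: remove_pair_time_def algebra_simps)
  show ?case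
  proof (cases "j = i")
    case True
    show ?thesis unfolding p True
      apply (rule fnI, simp add: prog_def)
      apply (rule ev_rules IH fn_eq | simp)+
       apply (simp add: remove_pair_def)
      using t unfolding p by simp
  next
    case False
    then have "i \<noteq> j" by simp
    then show ?thesis unfolding p
      apply (intro fnI, simp add: prog_def)
      apply (rule ev_rules IH fn_eq fn_remove | simp)+
       apply (simp add: remove_pair_def)
      using t unfolding p by simp
  qed
qed

text \<open>Running off the end of \<open>S\<close> yields \<open>car Atom = Atom\<close>, in
  agreement with \<open>bit_at\<close>, which is false there.\<close>

lemma fn_bit_at: "fn 9 [enc_list enc_bool S, i] (enc_bool (bit_at S (len i))) (10 * len i + 10)"
proof (induction i arbitrary: S)
  case Atom
  show ?case
    by (cases S; rule fnI, simp add: prog_def, (rule ev_rules | simp add: bit_at_def)+)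
next
  case (Cell u i)
  have "fn 9 [enc_list enc_bool (tl S), i] (enc_bool (bit_at (tl S) (len i))) (10 * len i + 10)"
    by (rule Cell.IH)
  moreover have "cdr (enc_list enc_bool S) = enc_list enc_bool (tl S)" by (cases S) auto
  moreover have "bit_at S (Suc j) = bit_at (tl S) j" for j by (cases S) (auto simp: bit_at_def)
  ultimately show ?case
    apply (intro fnI, simp add: prog_def)
    by (rule ev_rules Cell.IH | simp)+
qed

lemma fn_concat:
  assumes "\<And>xs. xs \<in> set xss \<Longrightarrow> length xs \<le> c"
  shows "fn 11 [enc_list (enc_list f) xss] (enc_list f (concat xss)) ((10 * c + 30) * (length xss + 1))"
  using assms
proof (induction xss)
  case Nil
  show ?case
    by (rule fnI, simp add: prog_def) (rule ev_rules | simp)+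
next
  case (Cons xs xss)
  have IH: "fn 11 [enc_list (enc_list f) xss] (enc_list f (concat xss)) ((10 * c + 30) * (length xss + 1))"
    using Cons by auto
  have "length xs \<le> c" using Cons.prems by auto
  then show ?case
    apply (intro fnI, simp add: prog_def)
    by (rule ev_rules IH fn_append | simp)+
qed

lemma fn_length_le: "fn 12 [x, y] (enc_bool (len x \<le> len y)) (10 * len x + 10)"
proof (induction x arbitrary: y)
  case Atom
  show ?case
    by (rule fnI, simp add: prog_def) (rule ev_rules | simp)+
next
  case (Cell u x)
  show ?case
    by (cases y; rule fnI, simp add: prog_def, (rule ev_rules Cell.IH | simp)+)
qed

lemma fn_bit_lists_step:
  "fn 14 [enc_list (enc_list enc_bool) Ss] (enc_list (enc_list enc_bool)
    (concat (map (\<lambda>S. [False # S, True # S]) Ss))) (20 * length Ss + 20)"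
proof (induction Ss)
  case Nil
  show ?case
    by (rule fnI, simp add: prog_def) (rule ev_rules | simp)+
next
  case (Cons S Ss)
  show ?case
    by (rule fnI, simp add: prog_def) (rule ev_rules Cons.IH | simp)+
qed

lemma length_bit_lists: "length (bit_lists n) = 2 ^ n"
  by (induction n) (auto simp: length_concat comp_def sum_list_triv)

lemma fn_bit_lists:
  "fn 13 [x] (enc_list (enc_list enc_bool) (bit_lists (len x))) (100 * 2 ^ len x)"
proof (induction x)
  case Atom
  show ?case
    by (rule fnI, simp add: prog_def) (rule ev_rules | simp)+
next
  case (Cell u x)
  show ?case
    apply (rule fnI, simp add: prog_def)
    apply (rule ev_rules Cell.IH fn_bit_lists_step | simp add: length_bit_lists)+
    by (rule order_trans[of _ "40 * 1"]) simp_all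
qed

text \<open>The body strips two cells per counted unit, so the induction is on the length. A single
  last cell still counts, which rounds up.\<close>

lemma fn_half: "fn 18 [x] (enc_nat ((len x + 1) div 2)) (20 * len x + 20)"
proof (induction "len x" arbitrary: x rule: less_induct)
  case less
  show ?case
  proof (cases x)
    case Atom
    show ?thesis unfolding Atom
      by (rule fnI, simp add: prog_def) (rule ev_rules | simp)+
  next
    case (Cell u y)
    have y: "len (cdr y) = len y - 1" by (cases y) auto
    then have IH: "fn 18 [cdr y] (enc_nat ((len y - 1 + 1) div 2)) (20 * len (cdr y) + 20)"
      using less[of "cdr y"] Cell by simp
    have half: "Suc (Suc (len y)) div 2 = Suc ((len y - 1 + 1) div 2)"
      by (cases y) auto
    show ?thesis unfolding Cell
      apply (rule fnI, simp add: prog_def)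
      apply (rule ev_rules IH | simp del: One_nat_def)+
       apply (simp add: half del: div2_Suc_Suc)
      using y by simp
  qed
qed

lemma fn_index:
  assumes "i + length P = j"
  shows "fn 19 [enc_list (enc_list enc_nat) P, enc_nat i] (enc_list enc_entry (zip [i..<j] P))
    (20 * length P + 20)"
  using assms
proof (induction P arbitrary: i)
  case Nil
  show ?case
    by (rule fnI, simp add: prog_def) (rule ev_rules | simp)+
next
  case (Cons ps P)
  have IH: "fn 19 [enc_list (enc_list enc_nat) P, Cell Atom (enc_nat i)]
      (enc_list enc_entry (zip [Suc i..<j] P)) (20 * length P + 20)"
    using Cons.IH[of "Suc i"] Cons.prems by simp
  have "[i..<j] = i # [Suc i..<j]" using Cons.prems by (intro upt_conv_Cons) auto
  then show ?case
    apply (intro fnI, simp add: prog_def)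
    by (rule ev_rules IH | simp)+
qed

end

section \<open>Values and running time of the enumeration\<close>

definition bounded_state :: "nat \<Rightarrow> (nat \<times> nat list) list \<Rightarrow> bool" where
  "bounded_state n R \<longleftrightarrow> length R \<le> n \<and>
    (\<forall>(i, ps)\<in>set R. i \<le> n \<and> length ps \<le> n \<and> (\<forall>b\<in>set ps. b \<le> n))"

lemma bounded_state_remove_pair:
  "bounded_state n R \<Longrightarrow> bounded_state n (remove_pair i b R)"
proof -
  assume R: "bounded_state n R"
  have "length (remove_pair i b R) \<le> length R" by (simp add: remove_pair_def)
  moreover have "length (filter Q qs) \<le> n" if "length qs \<le> n" for Q :: "nat \<Rightarrow> bool" and qs
    using that length_filter_le[of Q qs] by linarith
  ultimately show ?thesis using R by (fastforce simp: bounded_state_def set_remove_pair)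
qed

lemma length_concat_map_le:
  assumes "\<And>x. x \<in> set xs \<Longrightarrow> length (f x) \<le> c"
  shows "length (concat (map f xs)) \<le> length xs * c"
  using assms by (induction xs) (auto simp: add_mono)

lemma length_choices_le: "length (choices fl ps) \<le> length ps"
  by (simp add: choices_def)

lemma set_choices_subset: "set (choices fl ps) \<subseteq> set ps"
  by (auto simp: choices_def dest: in_set_takeD)

text \<open>A step offers at most \<open>n\<close> agents with at most \<open>n\<close> items each,
  so it multiplies the number of outcomes by at most \<open>n * n\<close>.\<close>

lemma length_runs_le: "bounded_state n R \<Longrightarrow> length (runs fl k R acc) \<le> (n * n) ^ k"
proof (induction k arbitrary: R acc)
  case (Suc k)
  have inner: "length (concat (map (\<lambda>b. runs fl k (remove_pair i b R) ((i, b) # acc)) (choices fl ps)))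
      \<le> n * (n * n) ^ k" if "(i, ps) \<in> set R" for i ps
  proof -
    have "length (concat (map (\<lambda>b. runs fl k (remove_pair i b R) ((i, b) # acc)) (choices fl ps)))
        \<le> length (choices fl ps) * (n * n) ^ k"
      using Suc by (intro length_concat_map_le) (auto intro: bounded_state_remove_pair)
    also have "\<dots> \<le> n * (n * n) ^ k"
      using that Suc.prems length_choices_le[of fl ps]
      by (intro mult_right_mono) (auto simp: bounded_state_def intro: le_trans)
    finally show ?thesis .
  qed
  have "length (runs fl (Suc k) R acc) \<le> length R * (n * (n * n) ^ k)"
    unfolding runs.simps by (intro length_concat_map_le) (use inner in auto)
  also have "\<dots> \<le> n * (n * (n * n) ^ k)"
    using Suc.prems by (intro mult_right_mono) (auto simp: bounded_state_def)
  finally show ?case by (simp add: mult_ac)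
qed simp

text \<open>The nesting mirrors the loops: the outer \<open>n\<close> is for the agents, the inner
  one for the items. The terms with \<open>(n * n) ^ k\<close> pay for appending the lists of
  outcomes.\<close>

primrec runs_time :: "nat \<Rightarrow> nat \<Rightarrow> nat" where
  "runs_time n 0 = 10"
| "runs_time n (Suc k) = n * (n * (runs_time n k + remove_pair_time n * (n + 1) + 10 * (n * n) ^ k + 100)
     + 10 * (n * (n * n) ^ k) + 100) + 30"

context lisp_program
begin

text \<open>Functions 6, 7 and 8 are mutually recursive. The outer induction is on the number of
  steps; for a fixed number, the loops over items and agents are settled by inner
  inductions.\<close>

lemma fn_runs:
  assumes "bounded_state n R"
  shows "fn 6 [enc_nat k, enc_list enc_entry R, enc_bool fl, enc_list enc_pair acc]
    (enc_list (enc_list enc_pair) (runs fl k R acc)) (runs_time n k)"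
  using assms
proof (induction k arbitrary: R acc)
  case 0
  show ?case
    by (rule fnI, simp add: prog_def) (rule ev_rules | simp)+
next
  case (Suc k)
  define s where "s = runs_time n k + remove_pair_time n * (n + 1) + 10 * (n * n) ^ k + 100"
  have R: "bounded_state n R" by fact
  \<comment> \<open>The loop consumes the item list \<open>bs\<close>, while every removal acts on
    the unchanged state \<open>R\<close>; hence \<open>bs\<close> is arbitrary here.\<close>
  have take: "fn 8 [enc_nat k, enc_list enc_nat bs, enc_nat i, enc_list enc_entry R, enc_bool fl, enc_list enc_pair acc]
      (enc_list (enc_list enc_pair) (concat (map (\<lambda>b. runs fl k (remove_pair i b R) ((i, b) # acc)) bs)))
      (length bs * s + 10)"
    if "\<forall>b\<in>set bs. b \<le> n" and i: "i \<le> n" for bs i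
    using that(1)
  proof (induction bs)
    case Nil
    show ?case
      by (rule fnI, simp add: prog_def) (rule ev_rules | simp)+
  next
    case (Cons b bs)
    have IH: "fn 8 [enc_nat k, enc_list enc_nat bs, enc_nat i, enc_list enc_entry R, enc_bool fl, enc_list enc_pair acc]
      (enc_list (enc_list enc_pair) (concat (map (\<lambda>b. runs fl k (remove_pair i b R) ((i, b) # acc)) bs)))
      (length bs * s + 10)" using Cons by auto
    have "remove_pair_time n * (length R + 1) \<le> remove_pair_time n * (n + 1)"
      using R by (intro mult_left_mono) (auto simp: bounded_state_def)
    then have rem: "fn 5 [enc_nat i, enc_nat b, enc_list enc_entry R]
        (enc_list enc_entry (remove_pair i b R)) (remove_pair_time n * (n + 1))"
      using fn_remove_pair[of i n b R] i Cons.prems R unfolding fn_def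
      by (force simp: bounded_state_def intro: ev_mono)
    have run: "fn 6 [enc_nat k, enc_list enc_entry (remove_pair i b R), enc_bool fl,
        Cell (Cell (enc_nat i) (enc_nat b)) (enc_list enc_pair acc)]
        (enc_list (enc_list enc_pair) (runs fl k (remove_pair i b R) ((i, b) # acc))) (runs_time n k)"
      using Suc.IH[OF bounded_state_remove_pair[OF R], of i b "(i, b) # acc"] by simp
    have "length (runs fl k (remove_pair i b R) ((i, b) # acc)) \<le> (n * n) ^ k"
      using R by (intro length_runs_le bounded_state_remove_pair)
    then show ?case
      apply (intro fnI, simp add: prog_def)
        apply (rule ev_rules IH rem run fn_append | simp)+
      by (simp add: s_def)
  qed
  define s' where "s' = n * s + 10 * (n * (n * n) ^ k) + 100"
  \<comment> \<open>Likewise the loop over agents consumes \<open>Q\<close>, while \<open>R\<close>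
    is kept apart for the removals.\<close>
  have pick: "fn 7 [enc_nat k, enc_list enc_entry Q, enc_list enc_entry R, enc_bool fl, enc_list enc_pair acc]
      (enc_list (enc_list enc_pair) (concat (map (\<lambda>(i, ps). concat (map (\<lambda>b.
         runs fl k (remove_pair i b R) ((i, b) # acc)) (choices fl ps))) Q)))
      (length Q * s' + 10)"
    if "set Q \<subseteq> set R" for Q
    using that
  proof (induction Q)
    case Nil
    show ?case
      by (rule fnI, simp add: prog_def) (rule ev_rules | simp)+
  next
    case (Cons p Q)
    obtain i ps where p: "p = (i, ps)" by (cases p)
    have IH: "fn 7 [enc_nat k, enc_list enc_entry Q, enc_list enc_entry R, enc_bool fl, enc_list enc_pair acc]
      (enc_list (enc_list enc_pair) (concat (map (\<lambda>(i, ps). concat (map (\<lambda>b.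
         runs fl k (remove_pair i b R) ((i, b) # acc)) (choices fl ps))) Q)))
      (length Q * s' + 10)" using Cons by auto
    have b: "i \<le> n" "\<forall>b\<in>set ps. b \<le> n" "length ps \<le> n"
      using Cons.prems R p by (auto simp: bounded_state_def)
    have "\<forall>b\<in>set (choices fl ps). b \<le> n" using b(2) by (auto dest: subsetD[OF set_choices_subset])
    note t = take[OF this b(1)]
    have l: "length (choices fl ps) \<le> n" using length_choices_le[of fl ps] b(3) by linarith
    then have l1: "length (choices fl ps) * s \<le> n * s" by simp
    have "length (concat (map (\<lambda>b. runs fl k (remove_pair i b R) ((i, b) # acc)) (choices fl ps)))
        \<le> length (choices fl ps) * (n * n) ^ k"
      using R by (intro length_concat_map_le length_runs_le bounded_state_remove_pair)
    also have "\<dots> \<le> n * (n * n) ^ k" using l by simp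
    finally have l2: "length (concat (map (\<lambda>b. runs fl k (remove_pair i b R) ((i, b) # acc)) (choices fl ps)))
        \<le> n * (n * n) ^ k" .
    have l3: "length (choices fl ps) * s
        + 10 * length (concat (map (\<lambda>b. runs fl k (remove_pair i b R) ((i, b) # acc)) (choices fl ps)))
        \<le> n * s + 10 * (n * (n * n) ^ k)" using l1 l2 by linarith
    \<comment> \<open>This expression is \<open>choices\<close> written inline: the whole list with
      the flag, otherwise its prefix of length at most one.\<close>
    have opt: "ev (prog entry q) [enc_nat k, enc_list enc_entry (p # Q), enc_list enc_entry R, enc_bool fl, enc_list enc_pair acc]
        (EIf (EVar 3) (ECdr (ECar (EVar 1)))
            (EIf (ECdr (ECar (EVar 1))) (ECons (ECar (ECdr (ECar (EVar 1)))) EAtom) EAtom))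
        (enc_list enc_nat (choices fl ps)) 20"
      unfolding p choices_def
      by (cases fl; cases ps; rule ev_mono, (rule ev_rules | simp)+)
    show ?case
      apply (rule fnI, simp add: prog_def)
        apply (rule opt[unfolded p, simplified] ev_rules IH t fn_append | simp add: p)+
      using l3 by (simp add: s'_def)
  qed
  have "length R * s' \<le> n * s'" using R by (intro mult_right_mono) (auto simp: bounded_state_def)
  moreover have "runs_time n (Suc k) = n * s' + 30"
    by (simp add: s'_def s_def)
  ultimately have t: "length R * s' + 30 \<le> runs_time n (Suc k)" by linarith
  show ?case
    apply (rule fnI, simp add: prog_def)
      apply (rule ev_rules pick[OF order_refl] | simp del: runs_time.simps)+
    using t by linarith
qed

end

section \<open>Comparing cuts and searching for the least thinness\<close>

lemma bits_crossing_Nil [simp]: "bits_crossing n S [] = 0"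
  by (simp add: bits_crossing_def)

lemma bits_crossing_Cons [simp]:
  "bits_crossing n S ((i, j) # L) =
    (if bit_at S i = bit_at S (n + j) then bits_crossing n S L else Suc (bits_crossing n S L))"
  by (simp add: bits_crossing_def)

lemma bits_crossing_le: "bits_crossing n S L \<le> length L"
  by (simp add: bits_crossing_def)

lemma thin_Nil [simp]: "thin n [] N X k M"
  by (simp add: thin_def)

text \<open>The factors stand in the order that \<open>len_drep\<close> produces, so that the
  comparison made by the program rewrites to this form.\<close>

lemma thin_Cons [simp]:
  "thin n (S # Ss) N X k M \<longleftrightarrow>
    bits_crossing n S M * N \<le> bits_crossing n S X * k \<and> thin n Ss N X k M"
  by (simp add: thin_def mult.commute)

definition crossing_time :: "nat \<Rightarrow> nat \<Rightarrow> nat" where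
  "crossing_time n w = 60 * n + 10 * w + 200"

definition thin_time :: "nat \<Rightarrow> nat \<Rightarrow> nat \<Rightarrow> nat" where
  "thin_time n \<rho> K = crossing_time n \<rho> * (n + 1) + crossing_time n K * (\<rho> * n + 1) + 10 * (n * \<rho>) + 100"

definition first_thin_time :: "nat \<Rightarrow> nat \<Rightarrow> nat \<Rightarrow> nat \<Rightarrow> nat" where
  "first_thin_time n \<rho> K s = thin_time n \<rho> K * (s + 1) + 50"

context lisp_program
begin

lemma fn_mono: "fn g args v b \<Longrightarrow> b \<le> c \<Longrightarrow> fn g args v c"
  unfolding fn_def by (metis ev_mono)

text \<open>Count and multiplication are fused: \<open>w\<close> is appended once per crossing edge.
  The bit of item \<open>j\<close> is at position \<open>len P + j\<close>, and that index is formed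
  by appending the numeral \<open>j\<close> to \<open>P\<close>.\<close>

lemma fn_bits_crossing:
  assumes "set L \<subseteq> {..n} \<times> {..n}" "len P \<le> n" "len w \<le> W"
  shows "fn 10 [enc_list enc_bool S, P, enc_list enc_pair L, w] (drep (bits_crossing (len P) S L) w)
    (crossing_time n W * (length L + 1))"
  using assms(1)
proof (induction L)
  case Nil
  show ?case
    by (rule fnI, simp add: prog_def) (rule ev_rules | simp add: crossing_time_def)+
next
  case (Cons e L)
  obtain i j where e: "e = (i, j)" by (cases e)
  have ij: "i \<le> n" "j \<le> n" using Cons.prems e by auto
  have IH: "fn 10 [enc_list enc_bool S, P, enc_list enc_pair L, w] (drep (bits_crossing (len P) S L) w)
    (crossing_time n W * (length L + 1))" using Cons by auto
  have i: "fn 9 [enc_list enc_bool S, enc_nat i] (enc_bool (bit_at S i)) (10 * n + 10)"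
    using fn_mono[OF fn_bit_at[of S "enc_nat i"]] ij by simp
  have j: "fn 9 [enc_list enc_bool S, dapp P (enc_nat j)] (enc_bool (bit_at S (len P + j))) (20 * n + 10)"
    using fn_mono[OF fn_bit_at[of S "dapp P (enc_nat j)"]] ij assms by simp
  have P: "fn 2 [P, enc_nat j] (dapp P (enc_nat j)) (10 * n + 10)"
    using fn_mono[OF fn_append[of P "enc_nat j"]] assms by simp
  have w: "fn 2 [w, y] (dapp w y) (10 * W + 10)" for y
    using fn_mono[OF fn_append[of w y]] assms by simp
  show ?case unfolding e
    by (cases "bit_at S i"; cases "bit_at S (len P + j)"; rule fnI, simp add: prog_def rec_cnt_def,
        (rule ev_rules IH i j P w | simp add: crossing_time_def)+)
qed

lemma fn_thin:
  assumes "set M \<subseteq> {..n} \<times> {..n}" "set X \<subseteq> {..n} \<times> {..n}" "len P \<le> n" "length M \<le> n"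
    and "len w \<le> \<rho>" "length X \<le> \<rho> * n" "len k \<le> K"
  shows "fn 15 [enc_list (enc_list enc_bool) Ss, P, enc_list enc_pair M, w, enc_list enc_pair X, k]
    (enc_bool (thin (len P) Ss (len w) X (len k) M)) (thin_time n \<rho> K * (length Ss + 1))"
proof (induction Ss)
  case Nil
  show ?case
    by (rule fnI, simp add: prog_def) (rule ev_rules | simp add: thin_time_def)+
next
  case (Cons S Ss)
  have "crossing_time n \<rho> * (length M + 1) \<le> crossing_time n \<rho> * (n + 1)"
    using assms by (intro mult_left_mono) auto
  then have M: "fn 10 [enc_list enc_bool S, P, enc_list enc_pair M, w]
      (drep (bits_crossing (len P) S M) w) (crossing_time n \<rho> * (n + 1))"
    using fn_bits_crossing[of M n P w \<rho> S] assms fn_mono by blast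
  have "crossing_time n K * (length X + 1) \<le> crossing_time n K * (\<rho> * n + 1)"
    using assms by (intro mult_left_mono) auto
  then have X: "fn 10 [enc_list enc_bool S, P, enc_list enc_pair X, k]
      (drep (bits_crossing (len P) S X) k) (crossing_time n K * (\<rho> * n + 1))"
    using fn_bits_crossing[of X n P k K S] assms fn_mono by blast
  have "bits_crossing (len P) S M \<le> n"
    using bits_crossing_le[of "len P" S M] assms by linarith
  then have "10 * (bits_crossing (len P) S M * len w) \<le> 10 * (n * \<rho>)"
    using assms by (intro mult_left_mono mult_mono) auto
  then have le: "fn 12 [drep (bits_crossing (len P) S M) w, drep (bits_crossing (len P) S X) k]
      (enc_bool (bits_crossing (len P) S M * len w \<le> bits_crossing (len P) S X * len k)) (10 * (n * \<rho>) + 10)"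
    using fn_mono[OF fn_length_le[of "drep (bits_crossing (len P) S M) w" "drep (bits_crossing (len P) S X) k"]]
    by simp
  have eq: "thin_time n \<rho> K * (length (S # Ss) + 1) =
      crossing_time n \<rho> * (n + 1) + crossing_time n K * (\<rho> * n + 1) + 10 * (n * \<rho>) + 100
      + thin_time n \<rho> K * (length Ss + 1)"
    by (simp add: thin_time_def)
  show ?case
  proof (cases "bits_crossing (len P) S M * len w \<le> bits_crossing (len P) S X * len k")
    case True
    then have le': "fn 12 [drep (bits_crossing (len P) S M) w, drep (bits_crossing (len P) S X) k]
      (Cell Atom Atom) (10 * (n * \<rho>) + 10)" using le by simp
    show ?thesis
      apply (rule fnI, simp add: prog_def)
        apply (rule ev_rules M X le' Cons.IH | simp)+
      using True apply simp
      unfolding eq by simp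
  next
    case False
    then have le': "fn 12 [drep (bits_crossing (len P) S M) w, drep (bits_crossing (len P) S X) k]
      Atom (10 * (n * \<rho>) + 10)" using le by simp
    show ?thesis
      apply (rule fnI, simp add: prog_def)
        apply (rule ev_rules M X le' Cons.IH | simp)+
      using False apply simp
      unfolding eq by simp
  qed
qed

lemma fn_first_thin:
  assumes "\<And>M. M \<in> set Ms \<Longrightarrow> set M \<subseteq> {..n} \<times> {..n} \<and> length M \<le> n"
    and "set X \<subseteq> {..n} \<times> {..n}" "len P \<le> n"
    and "len w \<le> \<rho>" "length X \<le> \<rho> * n" "len k \<le> K" "length Ss = s"
  shows "fn 16 [enc_list (enc_list enc_pair) Ms, enc_list (enc_list enc_bool) Ss, P, w, enc_list enc_pair X, k]
    (enc_list enc_pair (first_thin (len P) Ss (len w) X (len k) Ms))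
    (first_thin_time n \<rho> K s * (length Ms + 1))"
  using assms(1)
proof (induction Ms)
  case Nil
  show ?case
    by (rule fnI, simp add: prog_def) (rule ev_rules | simp add: first_thin_time_def)+
next
  case (Cons M Ms)
  have IH: "fn 16 [enc_list (enc_list enc_pair) Ms, enc_list (enc_list enc_bool) Ss, P, w, enc_list enc_pair X, k]
    (enc_list enc_pair (first_thin (len P) Ss (len w) X (len k) Ms))
    (first_thin_time n \<rho> K s * (length Ms + 1))" using Cons by auto
  have th: "fn 15 [enc_list (enc_list enc_bool) Ss, P, enc_list enc_pair M, w, enc_list enc_pair X, k]
    (enc_bool (thin (len P) Ss (len w) X (len k) M)) (thin_time n \<rho> K * (s + 1))"
    using fn_thin[of M n X P w \<rho> k K Ss] Cons.prems assms by auto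
  have eq: "first_thin_time n \<rho> K s * (length (M # Ms) + 1) =
      thin_time n \<rho> K * (s + 1) + 50 + first_thin_time n \<rho> K s * (length Ms + 1)"
    by (simp add: first_thin_time_def)
  show ?case
  proof (cases "thin (len P) Ss (len w) X (len k) M")
    case True
    show ?thesis
      apply (rule fnI, simp add: prog_def)
        apply (rule ev_rules th[unfolded True[THEN eqTrueI] enc_bool_simps] IH | simp)+
      using True apply simp
      unfolding eq by simp
  next
    case False
    show ?thesis
      apply (rule fnI, simp add: prog_def)
        apply (rule ev_rules th[unfolded False[THEN Eq_FalseI] enc_bool_simps] IH | simp)+
      using False apply simp
      unfolding eq by simp
  qed
qed

text \<open>Induction on the distance \<open>r\<close> from the candidate \<open>j\<close> to the
  least thinness. Below it, function 16 returns \<open>Atom\<close>, that is, failure; at it, the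
  result is a matching, which is nonempty by assumption. On success function 16 runs twice, as test
  and for its value, hence the factor 2.\<close>

lemma fn_search:
  assumes "\<And>M. M \<in> set Ms \<Longrightarrow> set M \<subseteq> {..n} \<times> {..n} \<and> length M \<le> n" "[] \<notin> set Ms" "length Ms \<le> \<rho>"
    and "set X \<subseteq> {..n} \<times> {..n}" "len P \<le> n"
    and "len w \<le> \<rho>" "length X \<le> \<rho> * n" "length Ss = s"
    and kmin: "kmin = (LEAST k. \<exists>M\<in>set Ms. thin (len P) Ss (len w) X k M)"
      "\<exists>M\<in>set Ms. thin (len P) Ss (len w) X kmin M" "kmin \<le> K"
  shows "j + r = kmin \<Longrightarrow>
    fn 17 [enc_list (enc_list enc_pair) Ms, enc_list (enc_list enc_bool) Ss, P, w, enc_list enc_pair X, enc_nat j]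
    (enc_list enc_pair (thinnest (len P) Ss (len w) X Ms))
    ((2 * (first_thin_time n \<rho> K s * (\<rho> + 1)) + 50) * (r + 1))"
proof (induction r arbitrary: j)
  case (0 j)
  have ft: "fn 16 [enc_list (enc_list enc_pair) Ms, enc_list (enc_list enc_bool) Ss, P, w, enc_list enc_pair X, enc_nat j]
    (enc_list enc_pair (first_thin (len P) Ss (len w) X j Ms))
    (first_thin_time n \<rho> K s * (\<rho> + 1))"
    by (rule fn_mono, rule fn_first_thin[of Ms n X P w \<rho> "enc_nat j" K Ss s, simplified len_enc_nat])
       (use assms 0 in auto)
  have "first_thin (len P) Ss (len w) X j Ms \<in> set Ms"
    using first_thin_some[of Ms "len P" Ss "len w" X kmin] kmin 0 by simp
  then have ne: "first_thin (len P) Ss (len w) X j Ms \<noteq> []" using assms(2) by metis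
  have eq: "thinnest (len P) Ss (len w) X Ms = first_thin (len P) Ss (len w) X j Ms"
    using kmin(1) 0 by (simp add: thinnest_def)
  show ?case
    unfolding eq
    apply (rule fnI, simp add: prog_def)
      apply (rule ev_rules ft | simp add: ne)+
    done
next
  case (Suc r j)
  have ft: "fn 16 [enc_list (enc_list enc_pair) Ms, enc_list (enc_list enc_bool) Ss, P, w, enc_list enc_pair X, enc_nat j]
    (enc_list enc_pair (first_thin (len P) Ss (len w) X j Ms))
    (first_thin_time n \<rho> K s * (\<rho> + 1))"
    by (rule fn_mono, rule fn_first_thin[of Ms n X P w \<rho> "enc_nat j" K Ss s, simplified len_enc_nat])
       (use assms Suc.prems in auto)
  have "\<not> (\<exists>M\<in>set Ms. thin (len P) Ss (len w) X j M)"
    using Suc.prems unfolding kmin(1) by (intro not_less_Least) simp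
  then have ft': "first_thin (len P) Ss (len w) X j Ms = []"
    by (induction Ms) auto
  have IH: "fn 17 [enc_list (enc_list enc_pair) Ms, enc_list (enc_list enc_bool) Ss, P, w, enc_list enc_pair X, Cell Atom (enc_nat j)]
    (enc_list enc_pair (thinnest (len P) Ss (len w) X Ms))
    ((2 * (first_thin_time n \<rho> K s * (\<rho> + 1)) + 50) * (r + 1))"
    using Suc.IH[of "Suc j"] Suc.prems by simp
  show ?case
    apply (rule fnI, simp add: prog_def)
      apply (rule ev_rules ft[unfolded ft' enc_list.simps] IH | simp)+
    done
qed

end

definition mech_time :: "nat \<Rightarrow> nat \<Rightarrow> nat \<Rightarrow> nat \<Rightarrow> nat" where
  "mech_time n \<rho> \<tau> K = 2 * \<tau> + 100 * 2 ^ (n + n) + 200 * n + (10 * n + 30) * (\<rho> + 1)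
    + (2 * (first_thin_time n \<rho> K (2 ^ (n + n)) * (\<rho> + 1)) + 50) * (K + 1) + 300"

lemma bounded_state_index: "is_instance n P \<Longrightarrow> bounded_state n (index P)"
  by (fastforce simp: bounded_state_def index_def is_instance_def set_zip
      dest: distinct_card)

context lisp_program
begin

lemma fn_thinnest:
  assumes Ms: "\<And>M. M \<in> set Ms \<Longrightarrow> set M \<subseteq> {..n} \<times> {..n} \<and> length M \<le> n" "[] \<notin> set Ms" "length Ms \<le> \<rho>"
    and W: "\<And>M. M \<in> set W \<Longrightarrow> set M \<subseteq> {..n} \<times> {..n} \<and> length M \<le> n" "length W \<le> \<rho>"
    and P: "len P \<le> n" and s: "length Ss = s"
    and ex: "\<exists>M\<in>set Ms. thin (len P) Ss (length W) (concat W) k M" "k \<le> K"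
  shows "fn 21 [enc_list (enc_list enc_pair) Ms, enc_list (enc_list enc_bool) Ss, P, enc_list (enc_list enc_pair) W]
    (enc_list enc_pair (thinnest (len P) Ss (length W) (concat W) Ms))
    ((10 * n + 30) * (\<rho> + 1) + (2 * (first_thin_time n \<rho> K s * (\<rho> + 1)) + 50) * (K + 1) + 30)"
proof -
  let ?w = "enc_list (enc_list enc_pair) W"
  define kmin where "kmin = (LEAST k. \<exists>M\<in>set Ms. thin (len P) Ss (length W) (concat W) k M)"
  have kmin: "\<exists>M\<in>set Ms. thin (len P) Ss (length W) (concat W) kmin M" "kmin \<le> k"
    unfolding kmin_def using ex(1) by (rule LeastI, rule Least_le)
  have X: "set (concat W) \<subseteq> {..n} \<times> {..n}" using W by auto
  have "length (concat (map (\<lambda>x. x) W)) \<le> length W * n"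
    using W by (intro length_concat_map_le) auto
  also have "\<dots> \<le> \<rho> * n" using W by simp
  finally have lX: "length (concat W) \<le> \<rho> * n" by simp
  have "(10 * n + 30) * (length W + 1) \<le> (10 * n + 30) * (\<rho> + 1)"
    using W(2) by (intro mult_left_mono) auto
  then have c: "fn 11 [?w] (enc_list enc_pair (concat W)) ((10 * n + 30) * (\<rho> + 1))"
    using fn_concat[of W n enc_pair] W fn_mono by blast
  have "fn 17 [enc_list (enc_list enc_pair) Ms, enc_list (enc_list enc_bool) Ss, P, ?w,
      enc_list enc_pair (concat W), enc_nat 0]
    (enc_list enc_pair (thinnest (len P) Ss (len ?w) (concat W) Ms))
    ((2 * (first_thin_time n \<rho> K s * (\<rho> + 1)) + 50) * (kmin + 1))"
    by (rule fn_search[where kmin = kmin]) (use Ms W P s X lX kmin ex(2) in \<open>auto simp: kmin_def\<close>)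
  moreover have "(2 * (first_thin_time n \<rho> K s * (\<rho> + 1)) + 50) * (kmin + 1)
      \<le> (2 * (first_thin_time n \<rho> K s * (\<rho> + 1)) + 50) * (K + 1)"
    using kmin ex(2) by (intro mult_left_mono) auto
  ultimately have sr: "fn 17 [enc_list (enc_list enc_pair) Ms, enc_list (enc_list enc_bool) Ss, P, ?w,
      enc_list enc_pair (concat W), Atom]
    (enc_list enc_pair (thinnest (len P) Ss (length W) (concat W) Ms))
    ((2 * (first_thin_time n \<rho> K s * (\<rho> + 1)) + 50) * (K + 1))"
    using fn_mono by simp
  show ?thesis
    apply (rule fnI, simp add: prog_def)
      apply (rule ev_rules c sr | simp)+
    done
qed

lemma fn_thin_mechanism:
  assumes P: "is_instance n P" and m: "m \<le> n" "1 \<le> n \<Longrightarrow> 1 \<le> m"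
    and \<rho>: "\<And>k. k \<le> n \<Longrightarrow> (n * n) ^ k \<le> \<rho>" and \<tau>: "\<And>k. k \<le> n \<Longrightarrow> runs_time n k \<le> \<tau>"
    and ex: "1 \<le> n \<Longrightarrow> \<exists>M\<in>set (runs True m (index P) []). thin n (bit_lists (n + n))
      (length (dictator_runs P m)) (concat (dictator_runs P m)) k M" "k \<le> K"
  shows "fn 20 [enc_instance P, enc_nat m] (enc_list enc_pair (thin_mechanism P m)) (mech_time n \<rho> \<tau> K)"
proof (cases "P = []")
  case True
  show ?thesis unfolding enc_instance_def True
    by (rule fnI, simp add: prog_def) (rule ev_rules | simp add: thin_mechanism_def mech_time_def)+
next
  case False
  have lP: "length P = n" using P by (simp add: is_instance_def)
  then have n: "1 \<le> n" using False by (cases P) auto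
  define m' where "m' = (n + m + 1) div 2"
  have m': "m' \<le> n" using m by (simp add: m'_def)
  have b: "bounded_state n (index P)" by (rule bounded_state_index[OF P])
  let ?P = "enc_list (enc_list enc_nat) P"
  let ?Ms = "runs True m (index P) []" let ?W = "dictator_runs P m"
  have W: "?W = runs False m' (index P) []" by (simp add: dictator_runs_def lP m'_def)
  have range: "set xs \<subseteq> {..n} \<times> {..n} \<and> length xs = j" if "xs \<in> set (runs fl j (index P) [])" for xs fl j
    using runs_sound[OF index_state(1)[OF P] that] index_state(2)[OF P] by fastforce
  have idx: "fn 19 [?P, Atom] (enc_list enc_entry (index P)) (20 * n + 20)"
    using fn_index[of 0 P "length P"] by (simp add: index_def lP)
  have rT: "fn 6 [enc_nat m, enc_list enc_entry (index P), Cell Atom Atom, Atom]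
      (enc_list (enc_list enc_pair) ?Ms) \<tau>"
    using fn_mono[OF fn_runs[OF b, of m True "[]"] \<tau>[OF m(1)]] by simp
  have rF: "fn 6 [enc_nat m', enc_list enc_entry (index P), Atom, Atom]
      (enc_list (enc_list enc_pair) ?W) \<tau>"
    using fn_mono[OF fn_runs[OF b, of m' False "[]"] \<tau>[OF m']] by (simp add: W)
  have bl: "fn 13 [dapp ?P ?P] (enc_list (enc_list enc_bool) (bit_lists (n + n))) (100 * 2 ^ (n + n))"
    using fn_bit_lists[of "dapp ?P ?P"] unfolding len_dapp len_enc_list lP .
  have hf: "fn 18 [dapp ?P (enc_nat m)] (enc_nat m') (20 * (n + m) + 20)"
    using fn_half[of "dapp ?P (enc_nat m)"] unfolding len_dapp len_enc_list len_enc_nat lP m'_def .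
  have aP: "fn 2 [?P, y] (dapp ?P y) (10 * n + 10)" for y
    using fn_append[of ?P y] unfolding len_enc_list lP .
  have "fn 21 [enc_list (enc_list enc_pair) ?Ms, enc_list (enc_list enc_bool) (bit_lists (n + n)), ?P,
      enc_list (enc_list enc_pair) ?W]
    (enc_list enc_pair (thinnest (len ?P) (bit_lists (n + n)) (length ?W) (concat ?W) ?Ms))
    ((10 * n + 30) * (\<rho> + 1) + (2 * (first_thin_time n \<rho> K (2 ^ (n + n)) * (\<rho> + 1)) + 50) * (K + 1) + 30)"
  proof (rule fn_thinnest[where k = k])
    \<comment> \<open>A positive target size keeps the empty list free as the failure signal of the
      search.\<close>
    show "[] \<notin> set ?Ms" using range[of "[]" True m] m n by auto
    show "length ?Ms \<le> \<rho>" using length_runs_le[OF b] \<rho>[OF m(1)] by (rule le_trans)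
    show "length ?W \<le> \<rho>" unfolding W using length_runs_le[OF b] \<rho>[OF m'] by (rule le_trans)
  qed (use range m m' lP n ex in \<open>auto simp: W length_bit_lists\<close>)
  moreover have "thin_mechanism P m = thinnest (len ?P) (bit_lists (n + n)) (length ?W) (concat ?W) ?Ms"
    using False by (simp add: thin_mechanism_def lP)
  ultimately have main: "fn 21 [enc_list (enc_list enc_pair) ?Ms, enc_list (enc_list enc_bool) (bit_lists (n + n)), ?P,
      enc_list (enc_list enc_pair) ?W]
    (enc_list enc_pair (thin_mechanism P m))
    ((10 * n + 30) * (\<rho> + 1) + (2 * (first_thin_time n \<rho> K (2 ^ (n + n)) * (\<rho> + 1)) + 50) * (K + 1) + 30)"
    by simp
  show ?thesis unfolding enc_instance_def
    apply (rule fnI, simp add: prog_def)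
      apply (rule ev_rules idx rT rF bl hf aP main | simp add: False)+
    using m by (simp add: mech_time_def)
qed

section \<open>Arithmetic for rational target sizes\<close>

lemma ev_cdrs: "ev (prog entry q) [x] (cdrs k) ((cdr ^^ k) x) (k + 1)"
proof (induction k)
  case 0
  show ?case by (rule ev_mono) (rule ev_rules | simp)+
next
  case (Suc k)
  show ?case by (rule ev_mono) (rule ev_rules Suc.IH | simp)+
qed

lemma len_cdrs: "len ((cdr ^^ k) x) = len x - k"
proof (induction k)
  case (Suc k)
  have "len (cdr y) = len y - 1" for y by (cases y) auto
  then show ?case using Suc by simp
qed simp

text \<open>Repeated subtraction of \<open>q\<close>, where \<open>1 \<le> q\<close> makes each
  round shrink the argument. A last remainder below \<open>q\<close> still counts one round, which
  rounds up.\<close>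

lemma fn_divide:
  assumes q: "1 \<le> q"
  shows "fn 1 [x] (enc_nat ((len x + q - 1) div q)) ((q + 20) * (len x + 1))"
proof (induction "len x" arbitrary: x rule: less_induct)
  case less
  show ?case
  proof (cases x)
    case Atom
    show ?thesis unfolding Atom using q
      apply (intro fnI, simp add: prog_def)
      by (rule ev_rules | simp)+
  next
    case (Cell u y)
    let ?z = "(cdr ^^ q) x"
    have z: "len ?z = len x - q" by (rule len_cdrs)
    have lx: "len x = Suc (len y)" using Cell by simp
    have IH: "fn (Suc 0) [?z] (enc_nat ((len x - q + q - 1) div q)) ((q + 20) * (len ?z + 1))"
      using less[of ?z] q lx unfolding z by simp
    have step: "(len x + q - 1) div q = Suc ((len x - q + q - 1) div q)"
    proof (cases "q \<le> len x")
      case True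
      then obtain l where l: "len x = q + l" using le_Suc_ex by blast
      have eqs: "len x + q - 1 = (l + q - 1) + q" "len x - q + q - 1 = l + q - 1"
        using q l by auto
      show ?thesis unfolding eqs using q div_add_self2[of q "l + q - 1"] by simp
    next
      case False
      then have eqs: "len x + q - 1 = len y + q" "len x - q + q - 1 = q - 1" "len y < q" using lx q by auto
      show ?thesis unfolding eqs using q eqs(3) div_add_self2[of q "len y"] by simp
    qed
    have "(q + 20) * (len ?z + 1) \<le> (q + 20) * len x"
      using q lx unfolding z by (intro mult_left_mono) auto
    then have t: "(q + 20) * (len ?z + 1) + q + 20 \<le> (q + 20) * (len x + 1)" by simp
    have ne: "x \<noteq> Atom" using Cell by simp
    show ?thesis
      apply (rule fnI, simp add: prog_def)
        apply (rule ev_rules ev_cdrs IH | simp add: ne)+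
      using step apply simp
      using t by simp
  qed
qed

lemma ev_copies: "ev (prog entry q) [x] (copies p) (drep p x) (p * (10 * len x + 20) + 1)"
proof (induction p)
  case 0
  show ?case by (rule ev_mono) (rule ev_rules | simp)+
next
  case (Suc p)
  show ?case by (rule ev_mono) (rule ev_rules fn_append Suc.IH | simp)+
qed

end

section \<open>Time bounds of the form 2^poly(n)\<close>

definition exp_bounded :: "(nat \<Rightarrow> nat) \<Rightarrow> bool" where
  "exp_bounded g \<longleftrightarrow> (\<exists>p :: nat poly. \<forall>n. g n \<le> 2 ^ poly p n)"

lemma exp_bounded_const: "exp_bounded (\<lambda>n. c)"
  unfolding exp_bounded_def by (rule exI[of _ "[:c:]"]) (simp add: less_imp_le less_exp)

lemma exp_bounded_id: "exp_bounded (\<lambda>n. n)"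
  unfolding exp_bounded_def by (rule exI[of _ "[:0, 1:]"]) (simp add: less_imp_le less_exp)

lemma exp_bounded_mult:
  assumes "exp_bounded g" "exp_bounded h"
  shows "exp_bounded (\<lambda>n. g n * h n)"
proof -
  obtain p r :: "nat poly" where "\<forall>n. g n \<le> 2 ^ poly p n" "\<forall>n. h n \<le> 2 ^ poly r n"
    using assms by (auto simp: exp_bounded_def)
  then have "\<forall>n. g n * h n \<le> 2 ^ poly (p + r) n" by (simp add: power_add mult_mono)
  then show ?thesis unfolding exp_bounded_def by blast
qed

lemma exp_bounded_add:
  assumes "exp_bounded g" "exp_bounded h"
  shows "exp_bounded (\<lambda>n. g n + h n)"
proof -
  obtain p r :: "nat poly" where pr: "\<And>n. g n \<le> 2 ^ poly p n" "\<And>n. h n \<le> 2 ^ poly r n"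
    using assms unfolding exp_bounded_def by blast
  have "g n + h n \<le> 2 ^ poly (p + r + 1) n" for n
  proof -
    have "g n \<le> 2 ^ poly (p + r) n" "h n \<le> 2 ^ poly (p + r) n"
      using pr[of n] by (auto intro: le_trans power_increasing)
    then show ?thesis by simp
  qed
  then show ?thesis unfolding exp_bounded_def by blast
qed

lemma exp_bounded_power:
  assumes "exp_bounded g"
  shows "exp_bounded (\<lambda>n. g n ^ n)"
proof -
  obtain p :: "nat poly" where p: "\<And>n. g n \<le> 2 ^ poly p n"
    using assms unfolding exp_bounded_def by blast
  have "g n ^ n \<le> 2 ^ poly (p * [:0, 1:]) n" for n
    using power_mono[OF p, of n n] by (simp add: power_mult[symmetric] mult.commute)
  then show ?thesis unfolding exp_bounded_def by blast
qed

lemmas exp_bounded_intros =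
  exp_bounded_const exp_bounded_id exp_bounded_mult exp_bounded_add exp_bounded_power

text \<open>One step of the recurrence for \<open>runs_time\<close> multiplies any common bound on
  \<open>runs_time n k\<close>, \<open>(n * n) ^ k\<close> and 1 by at most this number.\<close>

definition runs_base :: "nat \<Rightarrow> nat" where
  "runs_base n = n * n + n * n * (remove_pair_time n * (n + 1) + 100) + 20 * (n * n) + 100 * n + 30"

lemma runs_time_le: "runs_time n k \<le> runs_base n ^ Suc k"
proof (induction k)
  case (Suc k)
  let ?G = "runs_base n ^ Suc k"
  have G: "n * n \<le> runs_base n" "1 \<le> runs_base n" by (simp_all add: runs_base_def)
  have "(n * n) ^ k \<le> runs_base n ^ k" using G by (intro power_mono) auto
  also have "\<dots> \<le> ?G" using G by (intro power_increasing) auto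
  finally have nn: "(n * n) ^ k \<le> ?G" .
  have one: "1 \<le> ?G" using G by (intro one_le_power)
  have "runs_time n (Suc k) = n * n * runs_time n k + (n * n * (remove_pair_time n * (n + 1) + 100)) * 1
      + 20 * (n * n) * (n * n) ^ k + (100 * n + 30) * 1"
    by (simp add: algebra_simps)
  also have "\<dots> \<le> n * n * ?G + (n * n * (remove_pair_time n * (n + 1) + 100)) * ?G
      + 20 * (n * n) * ?G + (100 * n + 30) * ?G"
    using Suc.IH nn one by (intro add_mono mult_le_mono2) auto
  also have "\<dots> = runs_base n * ?G" unfolding runs_base_def by (simp only: algebra_simps)
  finally show ?case by simp
qed (simp add: runs_base_def)

text \<open>Adding 1 to \<open>n * n\<close> makes the power monotone in the exponent, also for
  \<open>n = 0\<close>. The last factor \<open>runs_base n\<close> is split off so that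
  \<open>exp_bounded_power\<close> meets the exponent \<open>n\<close> exactly.\<close>

definition total_time :: "nat \<Rightarrow> nat \<Rightarrow> nat" where
  "total_time c n = mech_time n ((n * n + 1) ^ n) (runs_base n ^ n * runs_base n) (c * n)"

lemma exp_bounded_total_time: "exp_bounded (total_time c)"
  unfolding total_time_def mech_time_def runs_base_def remove_pair_time_def first_thin_time_def
    thin_time_def crossing_time_def power_add
  by (intro exp_bounded_intros)

text \<open>A linear number of search rounds is harmless in an exponential time bound, and it keeps
  logarithms out of \<open>exp_bounded\<close>.\<close>

lemma thinness_bound_le:
  assumes "0 < \<epsilon>" "1 \<le> n"
  shows "thinness_bound \<epsilon> n \<le> nat \<lceil>8 / \<epsilon>\<rceil> * n"
proof -
  have "log 2 (real (2 * n)) \<le> real (2 * n)"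
    using assms by (intro log2_of_power_le) (auto intro: less_imp_le less_exp)
  then have "4 * log 2 (2 * n) / \<epsilon> \<le> 8 / \<epsilon> * n"
    using assms by (simp add: field_simps)
  also have "\<dots> \<le> nat \<lceil>8 / \<epsilon>\<rceil> * n"
    unfolding of_nat_mult by (intro mult_right_mono of_nat_ceiling) auto
  finally have "4 * log 2 (2 * n) / \<epsilon> \<le> real (nat \<lceil>8 / \<epsilon>\<rceil> * n)" by simp
  then show ?thesis unfolding thinness_bound_def by (simp only: nat_le_iff ceiling_le_iff of_int_of_nat_eq)
qed

lemma fn_mechanism_target:
  assumes eps: "0 < \<epsilon>" "\<epsilon> < 1" and P: "is_instance n P"
  shows "lisp_program.fn entry q 20 [enc_instance P, enc_nat (target_size \<epsilon> n)]
    (enc_list enc_pair (thin_mechanism P (target_size \<epsilon> n))) (total_time (nat \<lceil>8 / \<epsilon>\<rceil>) n)"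
proof -
  have "target_size \<epsilon> n \<le> n"
    using target_size_bounds(2)[OF eps] by (cases n) (auto simp: target_size_def)
  moreover have "(n * n) ^ k \<le> (n * n + 1) ^ n" if "k \<le> n" for k
    using that by (intro order_trans[OF power_mono power_increasing]) auto
  moreover have "runs_time n k \<le> runs_base n ^ n * runs_base n" if "k \<le> n" for k
  proof -
    have "runs_time n k \<le> runs_base n ^ Suc k" by (rule runs_time_le)
    also have "\<dots> \<le> runs_base n ^ Suc n"
      using that by (intro power_increasing) (auto simp: runs_base_def)
    finally show ?thesis by (simp add: mult.commute)
  qed
  moreover have "\<exists>k\<le>nat \<lceil>8 / \<epsilon>\<rceil> * n. 1 \<le> n \<longrightarrow>
      (\<exists>M\<in>set (runs True (target_size \<epsilon> n) (index P) []). thin n (bit_lists (n + n))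
        (length (dictator_runs P (target_size \<epsilon> n))) (concat (dictator_runs P (target_size \<epsilon> n))) k M)"
    using ex_thin_run[OF eps _ P] thinness_bound_le[OF eps(1)] by (cases "1 \<le> n") blast+
  ultimately show ?thesis unfolding total_time_def
    using target_size_bounds(1)[OF eps] lisp_program.fn_thin_mechanism[OF P] by blast
qed

lemma nat_ceiling_divide:
  assumes "1 \<le> q"
  shows "nat \<lceil>real a / real q\<rceil> = (a + q - 1) div q"
proof -
  let ?k = "(a + q - 1) div q"
  have le: "?k * q \<le> a + q - 1" by simp
  have "a + q - 1 < (?k + 1) * q" using assms dividend_less_div_times[of q "a + q - 1"] by simp
  then have "a \<le> ?k * q" using assms by simp
  then have "real a \<le> real ?k * q" by (metis of_nat_le_iff of_nat_mult)
  moreover have "real (?k * q) \<le> real (a + q - 1)" using le by (simp only: of_nat_le_iff)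
  then have "real ?k * q < real a + q" using assms by (simp add: of_nat_diff)
  ultimately have "\<lceil>real a / real q\<rceil> = int ?k"
    using assms by (intro ceiling_unique) (simp_all add: field_simps)
  then show ?thesis by simp
qed

lemma exp_time_computable_mechanism:
  assumes eps: "0 < \<epsilon>" "\<epsilon> < 1" and r: "exp_bounded r"
    and run: "\<And>n P. is_instance n P \<Longrightarrow> ev (prog entry q) (input P) entry
      (enc_list enc_pair (thin_mechanism P (target_size \<epsilon> n))) (r n)"
  shows "exp_time_computable input (\<lambda>P. set (thin_mechanism P (target_size \<epsilon> (length P))))"
proof -
  obtain p :: "nat poly" where p: "\<And>n. r n \<le> 2 ^ poly p n"
    using r unfolding exp_bounded_def by blast
  have entry: "prog entry q ! 0 = entry" "prog entry q \<noteq> []" by (simp_all add: prog_def)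
  have "distinct (thin_mechanism P (target_size \<epsilon> n))" if "is_instance n P" for n P
    using that thin_mechanism_matching(3)[OF eps _ that]
    by (cases "n = 0") (auto simp: thin_mechanism_def is_instance_def)
  moreover have "length P = n" if "is_instance n P" for n P
    using that by (simp add: is_instance_def)
  moreover have "runs_within (prog entry q) (input P)
      (enc_list enc_pair (thin_mechanism P (target_size \<epsilon> n))) (2 ^ poly p n)"
    if "is_instance n P" for n P
    using run[OF that] p[of n] entry unfolding runs_within_def ev_def by (metis le_trans)
  ultimately show ?thesis unfolding exp_time_computable_def by metis
qed

text \<open>The entry merely passes on its two arguments. Division is called only by the entry for
  rational \<open>\<epsilon>\<close>, so the divisor 0 is an arbitrary choice.\<close>

lemma exp_time_computable_with_target:
  assumes eps: "0 < \<epsilon>" "\<epsilon> < 1"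
  shows "exp_time_computable (\<lambda>P. [enc_instance P, enc_nat (target_size \<epsilon> (length P))])
    (\<lambda>P. set (thin_mechanism P (target_size \<epsilon> (length P))))"
proof (rule exp_time_computable_mechanism[OF eps, where entry = "ECall 20 [EVar 0, EVar 1]" and q = 0])
  let ?r = "\<lambda>n. total_time (nat \<lceil>8 / \<epsilon>\<rceil>) n + 3"
  show "exp_bounded ?r" by (intro exp_bounded_add exp_bounded_total_time exp_bounded_const)
  fix n P assume P: "is_instance n P"
  then have n: "length P = n" by (simp add: is_instance_def)
  show "ev (prog (ECall 20 [EVar 0, EVar 1]) 0) [enc_instance P, enc_nat (target_size \<epsilon> (length P))]
      (ECall 20 [EVar 0, EVar 1]) (enc_list enc_pair (thin_mechanism P (target_size \<epsilon> n))) (?r n)"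
    unfolding n
    by (rule ev_mono) (rule lisp_program.ev_rules fn_mechanism_target[OF eps P] | simp)+
qed

text \<open>Writing \<open>1 - \<epsilon> = p / q\<close> makes the target size
  \<open>\<lceil>p * n / q\<rceil>\<close>. The entry computes it from the instance alone, which as
  a list of length \<open>n\<close> serves as the number \<open>n\<close>.\<close>

lemma exp_time_computable_rational:
  assumes eps: "0 < \<epsilon>" "\<epsilon> < 1" "\<epsilon> \<in> \<rat>"
  shows "exp_time_computable (\<lambda>P. [enc_instance P])
    (\<lambda>P. set (thin_mechanism P (target_size \<epsilon> (length P))))"
proof -
  have "1 - \<epsilon> \<in> \<rat>" "0 \<le> 1 - \<epsilon>" using eps by auto
  then obtain p q :: nat where pq: "q \<noteq> 0" "1 - \<epsilon> = real p / real q"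
    by (metis Rats_abs_nat_div_natE abs_of_nonneg)
  let ?e = "ECall 20 [EVar 0, ECall 1 [copies p]]"
  let ?r = "\<lambda>n. total_time (nat \<lceil>8 / \<epsilon>\<rceil>) n + (p * (10 * n + 20) + (q + 20) * (p * n + 1) + 10)"
  show ?thesis
  proof (rule exp_time_computable_mechanism[OF eps(1,2), where entry = ?e and q = q])
    show "exp_bounded ?r"
      by (intro exp_bounded_add exp_bounded_mult exp_bounded_total_time exp_bounded_const exp_bounded_id)
    fix n P assume P: "is_instance n P"
    then have n: "len (enc_instance P) = n" by (simp add: is_instance_def enc_instance_def)
    have "target_size \<epsilon> n = (p * n + q - 1) div q"
      using nat_ceiling_divide[of q "p * n"] pq by (simp add: target_size_def)
    then have d: "lisp_program.fn ?e q 1 [drep p (enc_instance P)]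
        (enc_nat (target_size \<epsilon> n)) ((q + 20) * (p * n + 1))"
      using lisp_program.fn_divide[of q ?e "drep p (enc_instance P)"] pq(1) n by (simp del: One_nat_def)
    have c: "ev (prog ?e q) [enc_instance P] (copies p) (drep p (enc_instance P)) (p * (10 * n + 20) + 1)"
      using lisp_program.ev_copies[of ?e q "enc_instance P" p] n by simp
    show "ev (prog ?e q) [enc_instance P] ?e
        (enc_list enc_pair (thin_mechanism P (target_size \<epsilon> n))) (?r n)"
      by (rule ev_mono) (rule lisp_program.ev_rules d c fn_mechanism_target[OF eps(1,2) P] | simp del: One_nat_def)+
  qed
qed

theorem mainTheorem10:
  fixes \<epsilon> :: real
  assumes "0 < \<epsilon>" and "\<epsilon> < 1"
  shows "\<exists>(K :: real) (f :: nat list list \<Rightarrow> (nat \<times> nat) set).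
    is_exp_time_mechanism \<epsilon> f \<and>
    (\<forall>(n :: nat) P. 2 \<le> n \<longrightarrow> is_instance n P \<longrightarrow>
       card (f P) = target_size \<epsilon> n \<and>
       (\<forall>d M_opt. is_metric n d \<longrightarrow> consistent P d \<longrightarrow>
          is_min_cost_perfect_matching n d M_opt \<longrightarrow>
          cost d (f P) \<le> K * (ln (real n))\<^sup>2 * cost d M_opt))"
proof (intro exI conjI allI impI)
  let ?f = "\<lambda>P. set (thin_mechanism P (target_size \<epsilon> (length P)))"
  let ?K = "1296 / (\<epsilon>\<^sup>2 * (ln 2)\<^sup>2)"
  have len: "length P = n" if "is_instance n P" for n P
    using that by (simp add: is_instance_def)
  \<comment> \<open>A mechanism must return a matching for every \<open>n\<close>, so the empty
    instance is checked separately.\<close>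
  have "is_matching n (?f P)" if "is_instance n P" for n P
    using that thin_mechanism_matching(1)[OF assms _ that] len[OF that]
    by (cases "n = 0") (auto simp: thin_mechanism_def is_matching_def)
  then show "is_exp_time_mechanism \<epsilon> ?f"
    using exp_time_computable_with_target[OF assms] exp_time_computable_rational[OF assms]
    by (simp add: is_exp_time_mechanism_def is_mechanism_def)
  fix n :: nat and P :: "nat list list"
  assume n: "2 \<le> n" and P: "is_instance n P"
  then have n1: "1 \<le> n" by simp
  show "card (?f P) = target_size \<epsilon> n"
    using thin_mechanism_matching(2)[OF assms n1 P] len[OF P] by simp
  fix d M_opt
  assume d: "is_metric n d" "consistent P d" and opt: "is_min_cost_perfect_matching n d M_opt"
  have perfect: "is_perfect_matching n M_opt" using opt by (simp add: is_min_cost_perfect_matching_def)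
  have "0 \<le> cost d M_opt"
    unfolding cost_def using perfect d(1)
    by (intro sum_nonneg) (auto simp: is_perfect_matching_def is_matching_def is_metric_def points_def)
  then show "cost d (?f P) \<le> ?K * (ln (real n))\<^sup>2 * cost d M_opt"
    unfolding len[OF P]
    using thin_mechanism_cost[OF assms n1 P d perfect] polylog_bound[OF assms n]
    by (meson order_trans mult_right_mono)
qed

end
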